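(* Assume that $\rho$ is an $\alpha$-super log-concave measure on $\mathbb{R}^n$. Then $\rho$ satisfies the logarithmic Sobolev inequality $$\rho(f^2\log f^2)\le\frac{2}{\alpha}\,\rho(|\nabla f|^2)$$ for any smooth function $f$ on $\mathbb{R}^n$ with $\rho(f^2)=1$.
   Context: $\rho(f)=\int f\,d\rho$, $|\cdot|$ is the Euclidean norm and $\nabla$ the usual gradient on $\mathbb{R}^n$. A function $\theta:\mathbb{R}^n\to[0,\infty)$ is log-concave if $\theta(sx+ty)\ge\theta(x)^s\theta(y)^t$ for all $x,y\in\mathbb{R}^n$ and $s,t\ge 0$ with $s+t=1$. A (positive) measure on $\mathbb{R}^n$ is called log-concave if any of its convolutions with log-concave continuous functions of compact support has a log-concave density (with respect to Lebesgue measure). A (positive) measure $\rho$ on $\mathbb{R}^n$ is called $\alpha$-super log-concave, where $\alpha\ge 0$, if the measure $e^{\frac{\alpha}{2}|x|^2}\rho(dx)$ is log-concave.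
   Formalization: The measure ρ is assumed to have total mass at least 1 (for example, a probability measure), since for mass m < 1 the constant function f = m^(-1/2) violates the inequality; α is taken strictly positive so that 2/α is defined. *)

theory Defs
  imports "HOL-Analysis.Analysis" "HOL-Probability.Convolution"
begin

(* Since 0 powr 0 = 0, the endpoint cases {s, t} = {0, 1} are trivially true, just as
   they are with the convention 0^0 = 1. *)
definition log_concave :: "('a::real_vector \<Rightarrow> real) \<Rightarrow> bool" where
  "log_concave \<theta> \<longleftrightarrow>
     (\<forall>x. 0 \<le> \<theta> x) \<and>
     (\<forall>x y s t. 0 \<le> s \<longrightarrow> 0 \<le> t \<longrightarrow> s + t = 1 \<longrightarrow>
        \<theta> x powr s * \<theta> y powr t \<le> \<theta> (s *\<^sub>R x + t *\<^sub>R y))"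

definition compactly_supported :: "('a::euclidean_space \<Rightarrow> real) \<Rightarrow> bool" where
  "compactly_supported \<theta> \<longleftrightarrow> compact (closure (support_on UNIV \<theta>))"

(* The convolution of a measure with a function is taken as the convolution of measures,
   the function being identified with its density measure. The second factor is finite,
   so the product measure inside "convolution" is well behaved even when the first factor
   is not sigma-finite. Densities are real-valued, which makes a log-concave measure
   finite on compact sets. *)
definition log_concave_measure :: "(real ^ 'n) measure \<Rightarrow> bool" where
  "log_concave_measure \<mu> \<longleftrightarrow>
     sets \<mu> = sets borel \<and>
     (\<forall>\<theta>. log_concave \<theta> \<longrightarrow> continuous_on UNIV \<theta> \<longrightarrow> compactly_supported \<theta> \<longrightarrow>
        (\<exists>h. log_concave h \<and> h \<in> borel_measurable borel \<and>
             convolution \<mu> (density lborel (\<lambda>x. ennreal (\<theta> x)))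
               = density lborel (\<lambda>x. ennreal (h x))))"

definition super_log_concave_measure :: "real \<Rightarrow> (real ^ 'n) measure \<Rightarrow> bool" where
  "super_log_concave_measure \<alpha> \<rho> \<longleftrightarrow>
     0 \<le> \<alpha> \<and> sets \<rho> = sets borel \<and>
     log_concave_measure (density \<rho> (\<lambda>x. ennreal (exp (\<alpha> / 2 * (norm x)\<^sup>2))))"

fun continuously_differentiable :: "nat \<Rightarrow> ('a::euclidean_space \<Rightarrow> real) \<Rightarrow> bool" where
  "continuously_differentiable 0 f \<longleftrightarrow> continuous_on UNIV f"
| "continuously_differentiable (Suc k) f \<longleftrightarrow>
     (\<forall>x. f differentiable (at x)) \<and>
     (\<forall>v. continuously_differentiable k (\<lambda>x. frechet_derivative f (at x) v))"

definition smooth :: "('a::euclidean_space \<Rightarrow> real) \<Rightarrow> bool" where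
  "smooth f \<longleftrightarrow> (\<forall>k. continuously_differentiable k f)"

definition gradient :: "('a::real_inner \<Rightarrow> real) \<Rightarrow> 'a \<Rightarrow> 'a" where
  "gradient f x = (THE D. GDERIV f x :> D)"

(* Integral with values in the extended reals. Unlike the Bochner integral, it does not
   return 0 when exactly one of the positive and negative parts has infinite integral. *)
definition extended_integral :: "'a measure \<Rightarrow> ('a \<Rightarrow> real) \<Rightarrow> ereal" where
  "extended_integral M g =
     enn2ereal (\<integral>\<^sup>+ x. ennreal (g x) \<partial>M) - enn2ereal (\<integral>\<^sup>+ x. ennreal (- g x) \<partial>M)"

end

theory Submission
  imports Defs "HOL-Probability.Distributions"
begin

text \<open>
The logarithmic Sobolev inequality is the infinitesimal form of the Prekopa-Leindler inequality; this is
the argument of Bobkov and Ledoux. Write \<open>\<nu>\<close> for the log-concave measure with density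
\<open>exp (\<alpha> / 2 * (norm x)\<^sup>2)\<close> relative to \<open>\<rho>\<close>. For weights \<open>t + s = 1\<close> the Gaussian relating the two
measures satisfies
\<open>t * (norm x)\<^sup>2 + s * (norm y)\<^sup>2 = (norm z)\<^sup>2 + t * s * (norm (x - y))\<^sup>2\<close> with
\<open>z = t *\<^sub>R x + s *\<^sub>R y\<close>, and the last term is a gain that grows like \<open>(norm (x - z))\<^sup>2 / s\<close> as \<open>s\<close> tends
to zero. Hence for a function \<open>g\<close> with gradient \<open>G\<close> it dominates the difference between \<open>g x\<close> and \<open>g z\<close> up to an error
of order \<open>s * (norm (G z))\<^sup>2 / (2 * \<alpha>)\<close>, and Prekopa-Leindler bounds the norm of \<open>exp g\<close> of exponent
\<open>1 / t\<close>, up to the power \<open>s\<close> of the total mass, by the integral of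
\<open>exp (g + s * (norm G)\<^sup>2 / (2 * \<alpha>))\<close>. At \<open>s = 0\<close> both sides agree. Their derivatives are the entropy of \<open>exp g\<close> and
\<open>1 / (2 * \<alpha>)\<close> times the integral of \<open>(norm G)\<^sup>2 * exp g\<close>; with \<open>f\<^sup>2 = exp g\<close> this is the claim
(\<open>local_log_sobolev_exp\<close>, \<open>local_log_sobolev\<close>).

The measures need not have a density, and log-concavity is known only for their mollifications. The
Prekopa-Leindler inequality is therefore proved for bounded functions on Euclidean space (by induction on the
dimension from the Brunn-Minkowski inequality on the line), applied to the mollified measure, and
carried over to \<open>\<nu>\<close> by letting the mollification shrink, which is harmless for continuous functions
of compact support (\<open>prekopa_leindler_log_concave_measure\<close>).

To stay within compact support, everything is multiplied by the tent function, a cutoff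
that is itself log-concave and so does not disturb the argument; no derivative of it ever appears.
Removing the cutoff needs the total mass of \<open>\<rho>\<close> to be finite
(\<open>finite_measure_super_log_concave\<close>): then the negative part of the entropy is integrable, and the
inequality itself shows that the positive part is integrable whenever the energy is finite. For total
mass \<open>M\<close> the entropy carries an extra term \<open>ln M\<close>, which has the right sign because \<open>M \<ge> 1\<close>.
\<close>

section \<open>Brunn-Minkowski inequality on the line\<close>

lemma weighted_am_gm:
  fixes a b s t :: real
  assumes "0 \<le> a" "0 \<le> b" "0 < t" "0 < s" "t + s = 1"
  shows "a powr t * b powr s \<le> t * a + s * b"
proof (cases "a = 0 \<or> b = 0")
  case True
  then show ?thesis using assms by auto
next
  case False
  then show ?thesis using Youngs_inequality_0[of t s a b] assms by auto
qed

lemma emeasure_lborel_scaleR_image: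
  fixes A :: "real set"
  assumes "0 < t" "compact A"
  shows "emeasure lborel ((\<lambda>x. c + t * x) ` A) = ennreal t * emeasure lborel A"
proof -
  have comp: "compact ((\<lambda>x. c + t * x) ` A)"
    by (intro compact_continuous_image continuous_intros assms)
  have "emeasure lborel ((\<lambda>x. c + t * x) ` A) =
     emeasure (density (distr lborel borel (\<lambda>x. c + t * x)) (\<lambda>_. ennreal (abs t))) ((\<lambda>x. c + t * x) ` A)"
    using assms lborel_real_affine[of t c] by simp
  also have "\<dots> = ennreal t * emeasure lborel ((\<lambda>x. c + t * x) -` ((\<lambda>x. c + t * x) ` A))"
    using comp assms by (subst emeasure_density_const)
      (auto simp: emeasure_distr borel_compact)
  also have "(\<lambda>x. c + t * x) -` ((\<lambda>x. c + t * x) ` A) = A"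
    using assms by auto
  finally show ?thesis .
qed

text \<open>On the line the sumset contains the translate of the first set by the minimum of the second and the
translate of the second by the maximum of the first; the first lies to the left of the second, so
they overlap in a single point and their lengths add up.\<close>

lemma one_dim_brunn_minkowski_compact:
  fixes A B C :: "real set"
  assumes "0 < t" "0 < s" "compact A" "compact B" "A \<noteq> {}" "B \<noteq> {}" "C \<in> sets borel"
    and sub: "\<And>a b. a \<in> A \<Longrightarrow> b \<in> B \<Longrightarrow> t * a + s * b \<in> C"
  shows "ennreal t * emeasure lborel A + ennreal s * emeasure lborel B \<le> emeasure lborel C"
proof -
  obtain p where p: "p \<in> A" "\<And>a. a \<in> A \<Longrightarrow> a \<le> p"
    using compact_attains_sup[of A] assms by auto
  obtain q where q: "q \<in> B" "\<And>b. b \<in> B \<Longrightarrow> q \<le> b"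
    using compact_attains_inf[of B] assms by auto
  \<comment> \<open>The two translates meet only where the first ends and the second begins.\<close>
  let ?A = "(\<lambda>x. s * q + t * x) ` A" and ?B = "(\<lambda>x. t * p + s * x) ` B"
  have m: "compact ?A" "compact ?B"
    by (intro compact_continuous_image continuous_intros assms)+
  have "?A \<inter> ?B \<subseteq> {t * p + s * q}"
  proof
    fix z assume "z \<in> ?A \<inter> ?B"
    then obtain a b where ab: "a \<in> A" "b \<in> B" "z = s * q + t * a" "z = t * p + s * b" by auto
    have "t * a \<le> t * p" "s * q \<le> s * b" using p q ab assms by auto
    then have "z = t * p + s * q" using ab by linarith
    then show "z \<in> {t * p + s * q}" by simp
  qed
  then have "emeasure lborel (?A \<inter> ?B) \<le> emeasure lborel {t * p + s * q}"
    by (intro emeasure_mono) auto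
  then have null: "?A \<inter> ?B \<in> null_sets lborel"
    using m by (auto simp: null_sets_def borel_compact)
  have "ennreal t * emeasure lborel A + ennreal s * emeasure lborel B =
        emeasure lborel ?A + emeasure lborel ?B"
    using assms by (simp add: emeasure_lborel_scaleR_image)
  also have "\<dots> = emeasure lborel (?A \<union> ?B)"
    using m by (intro emeasure_Un'[symmetric] null) (auto simp: borel_compact)
  also have "\<dots> \<le> emeasure lborel C"
    using sub p q assms by (intro emeasure_mono) (auto simp: add.commute)
  finally show ?thesis .
qed

lemma bounded_borel_inner_compact:
  fixes A :: "real set"
  assumes "A \<in> sets borel" "bounded A" "A \<noteq> {}" "0 < e"
  shows "\<exists>K. compact K \<and> K \<noteq> {} \<and> K \<subseteq> A \<and> emeasure lborel A \<le> emeasure lborel K + ennreal e"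
proof -
  have "A \<in> sets lebesgue" using assms by simp
  then obtain T where T: "closed T" "T \<subseteq> A" "A - T \<in> lmeasurable" "emeasure lebesgue (A - T) < ennreal e"
    using sets_lebesgue_inner_closed[of A e] assms by metis
  obtain a where a: "a \<in> A" using assms by auto
  \<comment> \<open>The inner closed set may be empty; a point of \<open>A\<close> is added to keep the compact set nonempty.\<close>
  let ?K = "insert a T"
  have "compact ?K"
    using T assms by (auto simp: compact_eq_bounded_closed intro: bounded_subset)
  moreover have "emeasure lborel A \<le> emeasure lborel ?K + emeasure lborel (A - T)"
    using T assms by (intro order.trans[OF emeasure_mono emeasure_subadditive]) (auto intro: borel_closed)
  moreover have "emeasure lborel (A - T) = emeasure lebesgue (A - T)"
    using T assms by (auto intro: borel_closed)
  ultimately have "emeasure lborel A \<le> emeasure lborel ?K + ennreal e"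
    using T(4) by (metis add_left_mono less_imp_le order.trans)
  then show ?thesis using T a \<open>compact ?K\<close>
    by (intro exI[of _ ?K]) auto
qed

text \<open>For Borel sets the sumset need not be Borel, which is why an arbitrary Borel superset appears on the
right. The statement follows from the compact case by exhausting both sets from inside.\<close>

lemma one_dim_brunn_minkowski:
  fixes A B C :: "real set"
  assumes "0 < t" "0 < s" "A \<in> sets borel" "B \<in> sets borel" "bounded A" "bounded B"
    "A \<noteq> {}" "B \<noteq> {}" "C \<in> sets borel"
    and sub: "\<And>a b. a \<in> A \<Longrightarrow> b \<in> B \<Longrightarrow> t * a + s * b \<in> C"
  shows "ennreal t * emeasure lborel A + ennreal s * emeasure lborel B \<le> emeasure lborel C"
proof (rule ennreal_le_epsilon)
  fix e :: real assume e: "0 < e"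
  define d where "d = e / (t + s)"
  have d: "0 < d" using e assms by (simp add: d_def)
  obtain K where K: "compact K" "K \<noteq> {}" "K \<subseteq> A" "emeasure lborel A \<le> emeasure lborel K + ennreal d"
    using bounded_borel_inner_compact[of A d] assms d by auto
  obtain L where L: "compact L" "L \<noteq> {}" "L \<subseteq> B" "emeasure lborel B \<le> emeasure lborel L + ennreal d"
    using bounded_borel_inner_compact[of B d] assms d by auto
  have "ennreal t * emeasure lborel A + ennreal s * emeasure lborel B
     \<le> ennreal t * (emeasure lborel K + ennreal d) + ennreal s * (emeasure lborel L + ennreal d)"
    using K L by (intro add_mono mult_left_mono) auto
  also have "\<dots> = (ennreal t * emeasure lborel K + ennreal s * emeasure lborel L)
      + (ennreal t * ennreal d + ennreal s * ennreal d)"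
    by (simp add: distrib_left ac_simps)
  also have "ennreal t * ennreal d + ennreal s * ennreal d = ennreal e"
    using assms d by (simp add: ennreal_mult[symmetric] ennreal_plus[symmetric] del: ennreal_plus)
      (simp add: d_def add_divide_distrib[symmetric] distrib_right[symmetric])
  also have "ennreal t * emeasure lborel K + ennreal s * emeasure lborel L \<le> emeasure lborel C"
    using K L assms by (intro one_dim_brunn_minkowski_compact) auto
  finally show "ennreal t * emeasure lborel A + ennreal s * emeasure lborel B
     \<le> emeasure lborel C + ennreal e" by (simp add: add_right_mono)
qed

section \<open>Prekopa-Leindler inequality\<close>

lemma nn_integral_layer_cake:
  fixes u :: "real \<Rightarrow> real"
  assumes [measurable]: "u \<in> borel_measurable borel"
  shows "(\<integral>\<^sup>+x. ennreal (u x) \<partial>lborel)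
    = (\<integral>\<^sup>+\<tau>. indicator {0<..} \<tau> * emeasure lborel {x. \<tau> < u x} \<partial>lborel)"
proof -
  have "(\<integral>\<^sup>+x. ennreal (u x) \<partial>lborel)
      = (\<integral>\<^sup>+x. (\<integral>\<^sup>+\<tau>. indicator {0<..} \<tau> * indicator {x. \<tau> < u x} x \<partial>lborel) \<partial>lborel)"
  proof (rule nn_integral_cong)
    fix x
    have "(\<integral>\<^sup>+\<tau>. indicator {0<..} \<tau> * indicator {x. \<tau> < u x} x \<partial>lborel)
       = (\<integral>\<^sup>+\<tau>. indicator {0<..<u x} \<tau> \<partial>lborel)"
      by (intro nn_integral_cong) (auto simp: indicator_def)
    also have "\<dots> = ennreal (u x)"
      by (cases "0 \<le> u x") (simp_all add: ennreal_neg)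
    finally show "ennreal (u x) = (\<integral>\<^sup>+\<tau>. indicator {0<..} \<tau> * indicator {x. \<tau> < u x} x \<partial>lborel)"
      by simp
  qed
  also have "\<dots> = (\<integral>\<^sup>+\<tau>. (\<integral>\<^sup>+x. indicator {0<..} \<tau> * indicator {x. \<tau> < u x} x \<partial>lborel) \<partial>lborel)"
    by (rule lborel_pair.Fubini') simp
  also have "\<dots> = (\<integral>\<^sup>+\<tau>. indicator {0<..} \<tau> * emeasure lborel {x. \<tau> < u x} \<partial>lborel)"
    by (intro nn_integral_cong) (simp add: nn_integral_cmult)
  finally show ?thesis .
qed

lemma integrable_bounded_interval:
  fixes u :: "real \<Rightarrow> real"
  assumes [measurable]: "u \<in> borel_measurable borel"
    and "\<And>x. 0 \<le> u x" "\<And>x. u x \<le> C * indicator {-R..R} x"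
  shows "integrable lborel u"
proof (rule integrableI_bounded_set)
  show "AE x in lborel. x \<in> {-R..R} \<longrightarrow> norm (u x) \<le> C"
    using assms by (intro AE_I2) (metis abs_of_nonneg indicator_simps(1) mult.right_neutral real_norm_def)
  show "AE x in lborel. x \<notin> {-R..R} \<longrightarrow> u x = 0"
    using assms by (intro AE_I2) (metis indicator_simps(2) mult_zero_right order_antisym)
qed (auto simp: emeasure_lborel_Icc_eq)

text \<open>If both functions have supremum \<open>1\<close>, then for every level below \<open>1\<close> both superlevel sets are
nonempty, and the hypothesis puts their weighted sum inside the superlevel set of \<open>w\<close> at the same
level. Integrating the Brunn-Minkowski inequality over the levels even gives an arithmetic mean on the
left-hand side.\<close>

lemma prekopa_leindler_line_normalized:
  fixes u v w :: "real \<Rightarrow> real"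
  assumes ts: "0 < t" "0 < s" "t + s = 1"
    and [measurable]: "u \<in> borel_measurable borel" "v \<in> borel_measurable borel" "w \<in> borel_measurable borel"
    and u: "\<And>x. 0 \<le> u x" "\<And>x. u x \<le> 1 * indicator {-R..R} x"
    and v: "\<And>x. 0 \<le> v x" "\<And>x. v x \<le> 1 * indicator {-R..R} x"
    and w: "integrable lborel w" "\<And>x. 0 \<le> w x"
    and sup: "\<And>\<tau>. \<tau> < 1 \<Longrightarrow> \<exists>x. \<tau> < u x" "\<And>\<tau>. \<tau> < 1 \<Longrightarrow> \<exists>x. \<tau> < v x"
    and PL: "\<And>x y. u x powr t * v y powr s \<le> w (t * x + s * y)"
  shows "t * (\<integral>x. u x \<partial>lborel) + s * (\<integral>x. v x \<partial>lborel) \<le> (\<integral>x. w x \<partial>lborel)"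
proof -
  have iu: "integrable lborel u" and iv: "integrable lborel v"
    by (rule integrable_bounded_interval[OF _ u] integrable_bounded_interval[OF _ v], simp)+
  have le1: "u x \<le> 1" "v x \<le> 1" for x
    using u(2)[of x] v(2)[of x] by (cases "x \<in> {-R..R}"; simp)+
  have level: "ennreal t * emeasure lborel {x. \<tau> < u x} + ennreal s * emeasure lborel {x. \<tau> < v x}
     \<le> emeasure lborel {x. \<tau> < w x}" if "0 < \<tau>" for \<tau>
  proof (cases "\<tau> < 1")
    case True
    have "\<not> \<tau> < u x" "\<not> \<tau> < v x" if "x \<notin> {-R..R}" for x
      using u(2)[of x] v(2)[of x] \<open>0 < \<tau>\<close> that by auto
    then have bnd: "{x. \<tau> < u x} \<subseteq> {-R..R}" "{x. \<tau> < v x} \<subseteq> {-R..R}" by blast+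
    show ?thesis
    proof (rule one_dim_brunn_minkowski)
      show "{x. \<tau> < u x} \<in> sets borel" "{x. \<tau> < v x} \<in> sets borel" "{x. \<tau> < w x} \<in> sets borel"
        by measurable
      show "bounded {x. \<tau> < u x}" "bounded {x. \<tau> < v x}"
        using bnd bounded_subset bounded_closed_interval by blast+
      show "{x. \<tau> < u x} \<noteq> {}" "{x. \<tau> < v x} \<noteq> {}" using sup True by auto
      fix a b assume ab: "a \<in> {x. \<tau> < u x}" "b \<in> {x. \<tau> < v x}"
      \<comment> \<open>The same level can be used for all three functions because \<open>t + s = 1\<close>.\<close>
      have "\<tau> = \<tau> powr t * \<tau> powr s" using ts \<open>0 < \<tau>\<close> by (simp add: powr_add[symmetric])
      also have "\<dots> < u a powr t * v b powr s"
        using ab ts \<open>0 < \<tau>\<close> by (intro mult_strict_mono powr_less_mono2) auto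
      also have "\<dots> \<le> w (t * a + s * b)" by (rule PL)
      finally show "t * a + s * b \<in> {x. \<tau> < w x}" by simp
    qed (use ts in auto)
  next
    case False
    have "\<not> \<tau> < u x" "\<not> \<tau> < v x" for x using False le1[of x] by linarith+
    then show ?thesis by simp
  qed
  have "ennreal (t * (\<integral>x. u x \<partial>lborel) + s * (\<integral>x. v x \<partial>lborel))
      = ennreal t * (\<integral>\<^sup>+x. ennreal (u x) \<partial>lborel) + ennreal s * (\<integral>\<^sup>+x. ennreal (v x) \<partial>lborel)"
    using ts u v iu iv by (simp add: nn_integral_eq_integral ennreal_mult)
  also have "\<dots> = (\<integral>\<^sup>+\<tau>. ennreal t * (indicator {0<..} \<tau> * emeasure lborel {x. \<tau> < u x})
       + ennreal s * (indicator {0<..} \<tau> * emeasure lborel {x. \<tau> < v x}) \<partial>lborel)"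
    by (simp add: nn_integral_layer_cake nn_integral_add nn_integral_cmult)
  also have "\<dots> \<le> (\<integral>\<^sup>+\<tau>. indicator {0<..} \<tau> * emeasure lborel {x. \<tau> < w x} \<partial>lborel)"
    using level by (intro nn_integral_mono) (auto simp: indicator_def)
  also have "\<dots> = ennreal (\<integral>x. w x \<partial>lborel)"
    using w by (simp add: nn_integral_layer_cake[symmetric] nn_integral_eq_integral)
  finally show ?thesis using w by (subst (asm) ennreal_le_iff) auto
qed

text \<open>Rescaling by the suprema reduces to the normalized case, and the arithmetic mean obtained there
dominates the geometric one.\<close>

lemma prekopa_leindler_line:
  fixes u v w :: "real \<Rightarrow> real"
  assumes ts: "0 < t" "0 < s" "t + s = 1"
    and [measurable]: "u \<in> borel_measurable borel" "v \<in> borel_measurable borel" "w \<in> borel_measurable borel"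
    and u: "\<And>x. 0 \<le> u x" "\<And>x. u x \<le> C * indicator {-R..R} x"
    and v: "\<And>x. 0 \<le> v x" "\<And>x. v x \<le> C * indicator {-R..R} x"
    and w: "\<And>x. 0 \<le> w x" "\<And>x. w x \<le> C * indicator {-R..R} x"
    and PL: "\<And>x y. u x powr t * v y powr s \<le> w (t * x + s * y)"
  shows "(\<integral>x. u x \<partial>lborel) powr t * (\<integral>x. v x \<partial>lborel) powr s \<le> (\<integral>x. w x \<partial>lborel)"
proof (cases "(\<forall>x. u x = 0) \<or> (\<forall>x. v x = 0)")
  case True
  then have "(\<integral>x. u x \<partial>lborel) = 0 \<or> (\<integral>x. v x \<partial>lborel) = 0" by auto
  then show ?thesis using w by auto
next
  case False
  have iw: "integrable lborel w"
    by (rule integrable_bounded_interval[OF _ w]) simp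
  \<comment> \<open>Division by \<open>a\<close>, \<open>b\<close> and \<open>c\<close> normalizes the suprema and keeps the hypothesis.\<close>
  define a where "a = (SUP x. u x)"
  define b where "b = (SUP x. v x)"
  have le: "u x \<le> \<bar>C\<bar>" "v x \<le> \<bar>C\<bar>" for x
    using u(2)[of x] v(2)[of x] by (cases "x \<in> {-R..R}"; simp)+
  then have bdd: "bdd_above (range u)" "bdd_above (range v)" by (auto intro!: bdd_aboveI)
  have ua: "u x \<le> a" and vb: "v x \<le> b" for x
    unfolding a_def b_def by (intro cSUP_upper bdd UNIV_I)+
  obtain x0 y0 where "u x0 \<noteq> 0" "v y0 \<noteq> 0" using False by auto
  then have pos: "0 < a" "0 < b"
    using ua[of x0] u(1)[of x0] vb[of y0] v(1)[of y0] by auto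
  define c where "c = a powr t * b powr s"
  have c: "0 < c" using pos by (simp add: c_def)
  have "t * (\<integral>x. u x / a \<partial>lborel) + s * (\<integral>x. v x / b \<partial>lborel) \<le> (\<integral>x. w x / c \<partial>lborel)"
  proof (rule prekopa_leindler_line_normalized[where R = R])
    show "\<exists>x. \<tau> < u x / a" if "\<tau> < 1" for \<tau>
    proof -
      have "\<tau> * a < (SUP x. u x)" using that pos by (simp add: a_def[symmetric])
      then obtain x where "\<tau> * a < u x" using less_cSUP_iff[OF _ bdd(1)] by blast
      then show ?thesis using pos by (intro exI[of _ x]) (simp add: pos_less_divide_eq)
    qed
    show "\<exists>x. \<tau> < v x / b" if "\<tau> < 1" for \<tau>
    proof -
      have "\<tau> * b < (SUP x. v x)" using that pos by (simp add: b_def[symmetric])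
      then obtain x where "\<tau> * b < v x" using less_cSUP_iff[OF _ bdd(2)] by blast
      then show ?thesis using pos by (intro exI[of _ x]) (simp add: pos_less_divide_eq)
    qed
    show "u x / a \<le> 1 * indicator {-R..R} x" "v x / b \<le> 1 * indicator {-R..R} x" for x
      using ua[of x] vb[of x] u(2)[of x] v(2)[of x] pos
      by (cases "x \<in> {-R..R}"; simp add: divide_le_eq)+
    show "(u x / a) powr t * (v y / b) powr s \<le> w (t * x + s * y) / c" for x y
    proof -
      have "(u x / a) powr t * (v y / b) powr s = (u x powr t * v y powr s) / c"
        using u v pos by (simp add: powr_divide c_def)
      also have "\<dots> \<le> w (t * x + s * y) / c"
        using PL c by (intro divide_right_mono) auto
      finally show ?thesis .
    qed
  qed (use ts u v w iw pos c in auto)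
  then have "t * ((\<integral>x. u x \<partial>lborel) / a) + s * ((\<integral>x. v x \<partial>lborel) / b) \<le> (\<integral>x. w x \<partial>lborel) / c"
    by simp
  moreover have "((\<integral>x. u x \<partial>lborel) / a) powr t * ((\<integral>x. v x \<partial>lborel) / b) powr s
     \<le> t * ((\<integral>x. u x \<partial>lborel) / a) + s * ((\<integral>x. v x \<partial>lborel) / b)"
    using u v pos ts by (intro weighted_am_gm divide_nonneg_pos integral_nonneg) auto
  moreover have "((\<integral>x. u x \<partial>lborel) / a) powr t * ((\<integral>x. v x \<partial>lborel) / b) powr s
     = ((\<integral>x. u x \<partial>lborel) powr t * (\<integral>x. v x \<partial>lborel) powr s) / c"
    using u v pos by (simp add: powr_divide c_def)
  ultimately have "((\<integral>x. u x \<partial>lborel) powr t * (\<integral>x. v x \<partial>lborel) powr s) / c \<le> (\<integral>x. w x \<partial>lborel) / c"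
    by linarith
  then show ?thesis using c by (simp add: divide_le_cancel)
qed

lemma integrable_bounded_box:
  fixes u :: "('i \<Rightarrow> real) \<Rightarrow> real"
  assumes "finite I" and [measurable]: "u \<in> borel_measurable (PiM I (\<lambda>_. lborel))"
    and u: "\<And>x. x \<in> space (PiM I (\<lambda>_. lborel)) \<Longrightarrow> 0 \<le> u x"
       "\<And>x. x \<in> space (PiM I (\<lambda>_. lborel)) \<Longrightarrow> u x \<le> C * indicator (PiE I (\<lambda>_. {-R..R})) x"
  shows "integrable (PiM I (\<lambda>_. lborel)) u"
proof -
  interpret product_sigma_finite "\<lambda>_::'i. lborel :: real measure" by standard
  let ?M = "PiM I (\<lambda>_::'i. lborel :: real measure)"
  have box: "PiE I (\<lambda>_. {-R..R}) \<in> sets ?M"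
    using \<open>finite I\<close> by (intro sets_PiM_I_finite) auto
  show ?thesis
  proof (rule integrableI_bounded_set[OF box])
    have "emeasure lborel {-R..R} = ennreal (max 0 (2 * R))"
      by (simp add: emeasure_lborel_Icc_eq max_def)
    then show "emeasure ?M (PiE I (\<lambda>_. {-R..R})) < \<infinity>"
      using \<open>finite I\<close> by (subst emeasure_PiM) (auto simp: ennreal_power simp del: emeasure_lborel_Icc)
    show "AE x in ?M. x \<in> PiE I (\<lambda>_. {-R..R}) \<longrightarrow> norm (u x) \<le> C"
      using u by (intro AE_I2) (metis abs_of_nonneg indicator_simps(1) mult.right_neutral real_norm_def)
    show "AE x in ?M. x \<notin> PiE I (\<lambda>_. {-R..R}) \<longrightarrow> u x = 0"
      using u by (intro AE_I2) (metis indicator_simps(2) mult_zero_right order_antisym)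
  qed simp
qed

text \<open>Induction on the set of coordinates: the one-dimensional inequality, applied along the new coordinate,
says that the three marginals again satisfy the hypothesis. Boundedness with support in a fixed cube
is the integrability condition that passes to marginals.\<close>

lemma prekopa_leindler_PiM:
  fixes u v w :: "('i \<Rightarrow> real) \<Rightarrow> real" and I :: "'i set"
  defines "M \<equiv> \<lambda>I. PiM I (\<lambda>_::'i. lborel :: real measure)"
  assumes ts: "0 < t" "0 < s" "t + s = 1" and R: "0 \<le> R" and "finite I"
    and "0 \<le> C"
    and "u \<in> borel_measurable (M I)" "v \<in> borel_measurable (M I)" "w \<in> borel_measurable (M I)"
    and "\<And>x. x \<in> space (M I) \<Longrightarrow> 0 \<le> u x" "\<And>x. x \<in> space (M I) \<Longrightarrow> u x \<le> C * indicator (PiE I (\<lambda>_. {-R..R})) x"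
    and "\<And>x. x \<in> space (M I) \<Longrightarrow> 0 \<le> v x" "\<And>x. x \<in> space (M I) \<Longrightarrow> v x \<le> C * indicator (PiE I (\<lambda>_. {-R..R})) x"
    and "\<And>x. x \<in> space (M I) \<Longrightarrow> 0 \<le> w x" "\<And>x. x \<in> space (M I) \<Longrightarrow> w x \<le> C * indicator (PiE I (\<lambda>_. {-R..R})) x"
    and "\<And>x y. x \<in> space (M I) \<Longrightarrow> y \<in> space (M I) \<Longrightarrow>
       u x powr t * v y powr s \<le> w (\<lambda>i\<in>I. t * x i + s * y i)"
  shows "(\<integral>x. u x \<partial>M I) powr t * (\<integral>x. v x \<partial>M I) powr s \<le> (\<integral>x. w x \<partial>M I)"
  using \<open>finite I\<close> assms(7-)
proof (induction I arbitrary: u v w C rule: finite_induct)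
  case (empty u v w C)
  have "(\<lambda>i\<in>{}. t * ((\<lambda>_. undefined) i) + s * ((\<lambda>_. undefined) i)) = (\<lambda>_. undefined::real)"
    by (auto simp: restrict_def)
  then show ?case
    using empty(11)[of "\<lambda>_. undefined" "\<lambda>_. undefined"]
    by (simp add: M_def PiM_empty lebesgue_integral_count_space_finite)
next
  case (insert i I u v w C)
  interpret product_sigma_finite "\<lambda>_::'i. lborel :: real measure" by standard
  have sp: "space (M J) = PiE J (\<lambda>_. UNIV)" for J by (simp add: M_def space_PiM)
  have upd: "x(i := a) \<in> space (M (insert i I))" if "x \<in> space (M I)" for x and a :: real
    using that by (auto simp: sp PiE_def extensional_def)
  have box: "indicator (PiE (insert i I) (\<lambda>_. {-R..R})) (x(i := a))
     = (indicator (PiE I (\<lambda>_. {-R..R})) x * indicator {-R..R} a :: real)"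
    if "x \<in> space (M I)" for x a
  proof -
    have "x(i := a) \<in> PiE (insert i I) (\<lambda>_. {-R..R}) \<longleftrightarrow> x \<in> PiE I (\<lambda>_. {-R..R}) \<and> a \<in> {-R..R}"
      using that insert(2) by (auto simp: sp PiE_def extensional_def Pi_def)
    then show ?thesis by (simp add: indicator_def)
  qed
  define adm where "adm f \<longleftrightarrow> f \<in> borel_measurable (M (insert i I)) \<and>
     (\<forall>x\<in>space (M (insert i I)). 0 \<le> f x \<and> f x \<le> C * indicator (PiE (insert i I) (\<lambda>_. {-R..R})) x)"
    for f
  \<comment> \<open>Slices and marginals inherit measurability, boundedness and support, marginals with the constant multiplied by the side length of the cube.\<close>
  have slice: "(\<lambda>a. f (x(i := a))) \<in> borel_measurable borel"
       "\<And>a. 0 \<le> f (x(i := a))" "\<And>a. f (x(i := a)) \<le> (C * indicator (PiE I (\<lambda>_. {-R..R})) x) * indicator {-R..R} a"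
       "\<And>a. f (x(i := a)) \<le> C * indicator {-R..R} a"
       "0 \<le> (\<integral>a. f (x(i := a)) \<partial>lborel)"
       "(\<integral>a. f (x(i := a)) \<partial>lborel) \<le> (C * (2 * R)) * indicator (PiE I (\<lambda>_. {-R..R})) x"
    if adm: "adm f" and x: "x \<in> space (M I)" for f x
  proof -
    note f = adm[unfolded adm_def, THEN conjunct1] adm[unfolded adm_def, THEN conjunct2, rule_format, THEN conjunct1]
       adm[unfolded adm_def, THEN conjunct2, rule_format, THEN conjunct2]
    show m: "(\<lambda>a. f (x(i := a))) \<in> borel_measurable borel"
    proof -
      have "(\<lambda>a. x(i := a)) \<in> measurable lborel (M (insert i I))"
        unfolding M_def using x insert(2) by (intro measurable_fun_upd[where J=I]) (auto simp: M_def)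
      then show ?thesis using f(1) measurable_compose by fastforce
    qed
    show nn: "0 \<le> f (x(i := a))" for a using f(2) upd[OF x] by blast
    show le: "f (x(i := a)) \<le> (C * indicator (PiE I (\<lambda>_. {-R..R})) x) * indicator {-R..R} a" for a
      using f(3)[OF upd[OF x]] box[OF x] by (simp add: mult.assoc)
    show "f (x(i := a)) \<le> C * indicator {-R..R} a" for a
      using le[of a] insert.prems(1) by (cases "x \<in> PiE I (\<lambda>_. {-R..R})"; cases "a \<in> {-R..R}"; simp)
    show "0 \<le> (\<integral>a. f (x(i := a)) \<partial>lborel)" by (simp add: nn)
    have "(\<integral>a. f (x(i := a)) \<partial>lborel) \<le>
      (\<integral>a. (C * indicator (PiE I (\<lambda>_. {-R..R})) x) * indicator {-R..R} a \<partial>lborel)"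
      by (intro integral_mono le integrable_bounded_interval[OF m nn le] integrable_mult_right
            integrable_real_indicator) (auto simp: emeasure_lborel_Icc_eq)
    also have "\<dots> = (C * (2 * R)) * indicator (PiE I (\<lambda>_. {-R..R})) x" using R by simp
    finally show "(\<integral>a. f (x(i := a)) \<partial>lborel) \<le> (C * (2 * R)) * indicator (PiE I (\<lambda>_. {-R..R})) x" .
  qed
  have marg: "(\<lambda>x. \<integral>a. f (x(i := a)) \<partial>lborel) \<in> borel_measurable (M I)"
      "(\<integral>x. f x \<partial>M (insert i I)) = (\<integral>x. (\<integral>a. f (x(i := a)) \<partial>lborel) \<partial>M I)"
    if adm: "adm f" for f
  proof -
    note f = adm[unfolded adm_def, THEN conjunct1] adm[unfolded adm_def, THEN conjunct2, rule_format, THEN conjunct1]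
       adm[unfolded adm_def, THEN conjunct2, rule_format, THEN conjunct2]
    have "(\<lambda>(x, a). f (x(i := a))) \<in> borel_measurable (M I \<Otimes>\<^sub>M lborel)"
      using measurable_compose[OF measurable_add_dim[of i I "\<lambda>_. lborel"] f(1)[unfolded M_def]]
      by (simp add: M_def case_prod_beta')
    then show "(\<lambda>x. \<integral>a. f (x(i := a)) \<partial>lborel) \<in> borel_measurable (M I)"
      by (rule lborel.borel_measurable_lebesgue_integral)
    have "integrable (M (insert i I)) f"
      using f insert(1) unfolding M_def by (intro integrable_bounded_box) auto
    then show "(\<integral>x. f x \<partial>M (insert i I)) = (\<integral>x. (\<integral>a. f (x(i := a)) \<partial>lborel) \<partial>M I)"
      unfolding M_def using insert(1,2) by (intro product_integral_insert) auto
  qed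
  have u: "adm u" and v: "adm v" and w: "adm w"
    using insert.prems by (auto simp: adm_def)
  show ?case
    unfolding marg(2)[OF u] marg(2)[OF v] marg(2)[OF w]
  proof (rule insert.IH[where C = "C * (2 * R)"])
    show "0 \<le> C * (2 * R)" using R insert.prems(1) by simp
    fix x y assume x: "x \<in> space (M I)" and y: "y \<in> space (M I)"
    have z: "(\<lambda>j\<in>I. t * x j + s * y j) \<in> space (M I)" by (simp add: sp)
    show "(\<integral>a. u (x(i := a)) \<partial>lborel) powr t * (\<integral>a. v (y(i := a)) \<partial>lborel) powr s
      \<le> (\<integral>a. w ((\<lambda>j\<in>I. t * x j + s * y j)(i := a)) \<partial>lborel)"
    proof (rule prekopa_leindler_line[OF ts slice(1)[OF u x] slice(1)[OF v y] slice(1)[OF w z]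
          slice(2)[OF u x] slice(4)[OF u x] slice(2)[OF v y] slice(4)[OF v y]
          slice(2)[OF w z] slice(4)[OF w z]])
      fix a b :: real
      have "(\<lambda>j\<in>insert i I. t * (x(i := a)) j + s * (y(i := b)) j)
         = (\<lambda>j\<in>I. t * x j + s * y j)(i := t * a + s * b)"
        using insert(2) by (auto simp: fun_eq_iff restrict_def)
      then show "u (x(i := a)) powr t * v (y(i := b)) powr s
         \<le> w ((\<lambda>j\<in>I. t * x j + s * y j)(i := t * a + s * b))"
        using insert.prems(11)[OF upd[OF x] upd[OF y], of a b] by (simp only:)
    qed
  qed (fact marg(1)[OF u] marg(1)[OF v] marg(1)[OF w] | rule slice(5)[OF u] slice(6)[OF u]
       slice(5)[OF v] slice(6)[OF v] slice(5)[OF w] slice(6)[OF w], assumption)+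
qed

text \<open>The product version transported along the coordinate isomorphism.\<close>

lemma prekopa_leindler:
  fixes u v w :: "'a::euclidean_space \<Rightarrow> real"
  assumes ts: "0 < t" "0 < s" "t + s = 1"
    and [measurable]: "u \<in> borel_measurable borel" "v \<in> borel_measurable borel" "w \<in> borel_measurable borel"
    and u: "\<And>x. 0 \<le> u x" "\<And>x. u x \<le> C * indicator (cball 0 R) x"
    and v: "\<And>x. 0 \<le> v x" "\<And>x. v x \<le> C * indicator (cball 0 R) x"
    and w: "\<And>x. 0 \<le> w x" "\<And>x. w x \<le> C * indicator (cball 0 R) x"
    and PL: "\<And>x y. u x powr t * v y powr s \<le> w (t *\<^sub>R x + s *\<^sub>R y)"
  shows "(\<integral>x. u x \<partial>lborel) powr t * (\<integral>x. v x \<partial>lborel) powr s \<le> (\<integral>x. w x \<partial>lborel)"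
proof -
  define M where "M = PiM (Basis :: 'a set) (\<lambda>_. lborel :: real measure)"
  define e where "e = (\<lambda>x. \<Sum>b\<in>Basis. x b *\<^sub>R b :: 'a)"
  have e[measurable]: "e \<in> measurable M borel" unfolding e_def M_def by measurable
  have int: "(\<integral>x. f x \<partial>lborel) = (\<integral>x. f (e x) \<partial>M)" if [measurable]: "f \<in> borel_measurable borel"
    for f :: "'a \<Rightarrow> real"
    by (subst lborel_eq, subst integral_distr) (auto simp: e_def M_def)
  define K where "K = \<bar>C\<bar>"
  have bnd: "f (e x) \<le> K * indicator (PiE Basis (\<lambda>_. {-\<bar>R\<bar>..\<bar>R\<bar>})) x"
    if f: "\<And>x. 0 \<le> f x" "\<And>x. f x \<le> C * indicator (cball 0 R) x" and x: "x \<in> space M" for f x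
  proof (cases "e x \<in> cball 0 R")
    case True
    have "x \<in> PiE Basis (\<lambda>_. {-\<bar>R\<bar>..\<bar>R\<bar>})"
    proof -
      have "\<bar>x b\<bar> \<le> \<bar>R\<bar>" if b: "b \<in> Basis" for b
      proof -
        have "x b = e x \<bullet> b"
          using b by (simp add: e_def inner_sum_left inner_Basis if_distrib sum.delta cong: if_cong)
        then show ?thesis using Basis_le_norm[OF b, of "e x"] True by auto
      qed
      then show ?thesis using x by (auto simp: M_def space_PiM PiE_iff abs_le_iff minus_le_iff)
    qed
    then show ?thesis using f(2)[of "e x"] True by (simp add: K_def)
  next
    case False
    then have "f (e x) = 0" using f[of "e x"] by simp
    then show ?thesis by (simp add: K_def)
  qed
  show ?thesis
    unfolding int[OF assms(4)] int[OF assms(5)] int[OF assms(6)] M_def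
  proof (rule prekopa_leindler_PiM[OF ts, where R = "\<bar>R\<bar>" and C = K], goal_cases)
    case (13 x y)
    have "t *\<^sub>R e x + s *\<^sub>R e y = e (\<lambda>i\<in>Basis. t * x i + s * y i)"
      by (simp add: e_def scaleR_sum_right sum.distrib[symmetric] scaleR_add_left)
    then show ?case using PL[of "e x" "e y"] by simp
  qed (use u v w bnd in \<open>auto simp: K_def M_def[symmetric]\<close>)
qed

section \<open>Log-concave functions and mollification of log-concave measures\<close>

lemma log_concave_convex_support:
  fixes h :: "'a::real_vector \<Rightarrow> real"
  assumes "log_concave h"
  shows "convex {x. 0 < h x}"
  unfolding convex_def
proof safe
  fix x y and s t :: real assume "0 < h x" "0 < h y" "0 \<le> s" "0 \<le> t" "s + t = 1"
  then have "0 < h x powr s * h y powr t" by simp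
  also have "\<dots> \<le> h (s *\<^sub>R x + t *\<^sub>R y)"
    using assms \<open>0 \<le> s\<close> \<open>0 \<le> t\<close> \<open>s + t = 1\<close> unfolding log_concave_def by blast
  finally show "0 < h (s *\<^sub>R x + t *\<^sub>R y)" .
qed

text \<open>The logarithm of a log-concave function is concave, hence continuous and bounded on a small ball
inside the support. Concavity along rays from the centre of that ball then bounds it from above by an
affine function of the norm: a steeper ascent outside would force too large a value on the sphere.\<close>

lemma log_concave_growth:
  fixes h :: "'a::euclidean_space \<Rightarrow> real"
  assumes h: "log_concave h" and int: "interior {x. 0 < h x} \<noteq> {}"
  shows "\<exists>A b. \<forall>x. h x \<le> A * exp (b * norm x)"
proof -
  have lc: "h x powr s * h y powr t \<le> h (s *\<^sub>R x + t *\<^sub>R y)" if "0 \<le> s" "0 \<le> t" "s + t = 1" for x y s t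
    using h that unfolding log_concave_def by blast
  obtain x0 where x0: "x0 \<in> interior {x. 0 < h x}" using int by auto
  have "convex_on (interior {x. 0 < h x}) (\<lambda>x. - ln (h x))"
  proof (rule convex_onI)
    show "convex (interior {x. 0 < h x})" by (intro convex_interior log_concave_convex_support h)
    fix s :: real and x y
    assume s: "0 < s" "s < 1" and "x \<in> interior {x. 0 < h x}" "y \<in> interior {x. 0 < h x}"
    then have pos: "0 < h x" "0 < h y" using interior_subset by blast+
    have "ln (h x powr (1 - s) * h y powr s) \<le> ln (h ((1 - s) *\<^sub>R x + s *\<^sub>R y))"
      using s pos lc[of "1 - s" s x y] by (intro ln_mono) auto
    also have "ln (h x powr (1 - s) * h y powr s) = (1 - s) * ln (h x) + s * ln (h y)"
      using pos by (simp add: ln_mult ln_powr)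
    finally show "- ln (h ((1 - s) *\<^sub>R x + s *\<^sub>R y)) \<le> (1 - s) * (- ln (h x)) + s * (- ln (h y))"
      by simp
  qed
  then have cont: "continuous_on (interior {x. 0 < h x}) (\<lambda>x. - ln (h x))"
    by (rule convex_on_continuous[OF open_interior])
  obtain r where r: "0 < r" "cball x0 r \<subseteq> interior {x. 0 < h x}"
    using x0 open_interior open_contains_cball by metis
  have "compact ((\<lambda>x. - ln (h x)) ` cball x0 r)"
    using cont r by (intro compact_continuous_image) (auto intro: continuous_on_subset)
  then obtain m where m: "\<And>x. x \<in> cball x0 r \<Longrightarrow> \<bar>- ln (h x)\<bar> \<le> m"
    by (metis (no_types, lifting) bounded_iff compact_imp_bounded imageI real_norm_def)
  have h0: "0 < h x0" using x0 interior_subset by blast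
  have ln_le: "ln (h y) \<le> m" if "y \<in> cball x0 r" for y using m[OF that] by linarith
  define \<beta> where "\<beta> = (m - ln (h x0)) / r"
  have \<beta>: "0 \<le> \<beta>" using ln_le[of x0] r by (simp add: \<beta>_def)
  have bound: "h x \<le> exp (m + \<beta> * norm (x - x0))" for x
  proof (cases "0 < h x")
    case False
    then show ?thesis by (meson exp_ge_zero linorder_not_less order.trans)
  next
    case pos: True
    have "ln (h x) \<le> m + \<beta> * norm (x - x0)"
    proof (cases "norm (x - x0) \<le> r")
      case True
      then have "ln (h x) \<le> m" by (intro ln_le) (simp add: dist_norm norm_minus_commute)
      then show ?thesis using \<beta> by (simp add: add_increasing2)
    next
      case False
      \<comment> \<open>The weight that brings \<open>x\<close> back to the sphere of radius \<open>r\<close> around \<open>x0\<close>.\<close>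
      define s where "s = r / norm (x - x0)"
      have "0 < norm (x - x0)" using False r by linarith
      then have s: "0 < s" "s < 1" using False r by (auto simp: s_def)
      let ?y = "s *\<^sub>R x + (1 - s) *\<^sub>R x0"
      have "?y - x0 = s *\<^sub>R (x - x0)" by (simp add: algebra_simps)
      then have "norm (?y - x0) = r" using \<open>0 < norm (x - x0)\<close> r by (simp add: s_def)
      then have y: "?y \<in> cball x0 r" by (simp add: dist_norm norm_minus_commute)
      have "s * ln (h x) + (1 - s) * ln (h x0) = ln (h x powr s * h x0 powr (1 - s))"
        using pos h0 by (simp add: ln_mult ln_powr)
      also have "\<dots> \<le> ln (h ?y)"
        using s pos h0 by (intro ln_mono lc mult_pos_pos) auto
      also have "\<dots> \<le> m" by (rule ln_le[OF y])
      finally have "s * (ln (h x) - ln (h x0)) \<le> m - ln (h x0)" by (simp add: algebra_simps)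
      then have "ln (h x) - ln (h x0) \<le> (m - ln (h x0)) / s" using s by (simp add: field_simps)
      also have "\<dots> = \<beta> * norm (x - x0)" using r by (simp add: \<beta>_def s_def)
      finally show ?thesis using ln_le[of x0] r by simp
    qed
    then show ?thesis using pos by (metis exp_le_cancel_iff exp_ln)
  qed
  have "h x \<le> exp (m + \<beta> * norm x0) * exp (\<beta> * norm x)" for x
  proof -
    have "\<beta> * norm (x - x0) \<le> \<beta> * (norm x + norm x0)"
      using \<beta> norm_triangle_ineq4 by (intro mult_left_mono)
    then have "exp (m + \<beta> * norm (x - x0)) \<le> exp ((m + \<beta> * norm x0) + \<beta> * norm x)"
      by (simp add: algebra_simps)
    from order.trans[OF bound this] show ?thesis by (simp only: exp_add)
  qed
  then show ?thesis by blast
qed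

text \<open>If the support has empty interior, it is a null set by convexity and the density may be replaced by
zero. So, up to almost-everywhere equality, a log-concave density always grows at most exponentially.\<close>

lemma log_concave_density_growth:
  fixes h :: "'a::euclidean_space \<Rightarrow> real"
  assumes h: "log_concave h" and [measurable]: "h \<in> borel_measurable borel"
  shows "\<exists>h' A b. log_concave h' \<and> h' \<in> borel_measurable borel \<and> 0 \<le> A \<and> 0 \<le> b \<and>
     (AE x in lborel. h x = h' x) \<and> (\<forall>x. h' x \<le> A * exp (b * norm x))"
proof (cases "interior {x. 0 < h x} = {}")
  case True
  then have "negligible {x. 0 < h x}"
    using negligible_convex_interior log_concave_convex_support[OF h] by blast
  then have "emeasure lborel {x. 0 < h x} = 0"
    by (simp add: negligible_iff_emeasure0)
  then have "AE x in lborel. \<not> 0 < h x"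
    by (subst AE_iff_measurable[OF _ refl]) auto
  then have "AE x in lborel. h x = 0"
    by (rule eventually_mono) (use h in \<open>auto simp: log_concave_def not_less intro: antisym\<close>)
  moreover have "log_concave (\<lambda>_::'a. 0)" by (simp add: log_concave_def)
  ultimately show ?thesis
    by (intro exI[of _ "\<lambda>_. 0"] exI[of _ 0]) auto
next
  case False
  then obtain A b where Ab: "\<And>x. h x \<le> A * exp (b * norm x)"
    using log_concave_growth[OF h] by auto
  have "h x \<le> \<bar>A\<bar> * exp (\<bar>b\<bar> * norm x)" for x
    by (rule order.trans[OF Ab]) (intro mult_mono; auto intro: mult_right_mono)
  then show ?thesis using h
    by (intro exI[of _ h] exI[of _ "\<bar>A\<bar>"] exI[of _ "\<bar>b\<bar>"]) auto
qed

text \<open>The tent serves both as a mollifier (small \<open>R\<close>) and as a cutoff (large \<open>R\<close>). It is concave on its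
support and therefore log-concave, so that neither use destroys log-concavity.\<close>

definition tent :: "real \<Rightarrow> 'a::real_normed_vector \<Rightarrow> real" where
  "tent R x = max 0 (1 - norm x / R)"

lemma tent_nonneg: "0 \<le> tent R x"
  by (simp add: tent_def)

lemma tent_eq_0: "0 < R \<Longrightarrow> R \<le> norm x \<Longrightarrow> tent R x = 0"
  by (simp add: tent_def)

lemma tent_le_1: "0 < R \<Longrightarrow> tent R x \<le> 1"
  by (simp add: tent_def)

lemma tent_pos: "0 < R \<Longrightarrow> norm x < R \<Longrightarrow> 0 < tent R x"
  by (simp add: tent_def less_max_iff_disj)

lemma continuous_on_tent: "continuous_on S (tent R)"
  unfolding tent_def[abs_def] divide_inverse by (intro continuous_intros)

lemma borel_measurable_tent[measurable]: "tent R \<in> borel_measurable borel"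
  by (intro borel_measurable_continuous_onI continuous_on_tent)

lemma log_concave_tent:
  assumes "0 < R" shows "log_concave (tent R :: 'a::real_normed_vector \<Rightarrow> real)"
  unfolding log_concave_def
proof (intro conjI allI impI)
  fix x y :: 'a and s t :: real assume st: "0 \<le> s" "0 \<le> t" "s + t = 1"
  show "tent R x powr s * tent R y powr t \<le> tent R (s *\<^sub>R x + t *\<^sub>R y)"
  proof (cases "tent R x = 0 \<or> tent R y = 0")
    case True
    then show ?thesis by (auto simp: tent_nonneg)
  next
    case False
    then have pos: "0 < tent R x" "0 < tent R y" using tent_nonneg[of R x] tent_nonneg[of R y] by auto
    then have eq: "tent R x = 1 - norm x / R" "tent R y = 1 - norm y / R" by (auto simp: tent_def max_def)
    have "tent R x powr s * tent R y powr t \<le> s * tent R x + t * tent R y"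
      using st pos by (intro Youngs_inequality_0)
    also have "\<dots> = (s + t) - (s * norm x + t * norm y) / R"
      unfolding eq using assms by (simp add: field_simps)
    also have "\<dots> \<le> 1 - norm (s *\<^sub>R x + t *\<^sub>R y) / R"
      using st assms norm_triangle_ineq[of "s *\<^sub>R x" "t *\<^sub>R y"]
      by (auto intro!: divide_right_mono)
    also have "\<dots> \<le> tent R (s *\<^sub>R x + t *\<^sub>R y)" by (simp add: tent_def)
    finally show ?thesis .
  qed
qed (simp add: tent_nonneg)

lemma compactly_supported_tent:
  assumes "0 < R" shows "compactly_supported (tent R :: 'a::euclidean_space \<Rightarrow> real)"
proof -
  have "support_on UNIV (tent R :: 'a \<Rightarrow> real) \<subseteq> ball 0 R"
    using tent_eq_0[OF assms] by (force simp: support_on_def not_less[symmetric])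
  then show ?thesis unfolding compactly_supported_def
    using bounded_subset[OF bounded_ball] by (auto simp: compact_closure)
qed

text \<open>The type argument fixes the dimension, which \<open>R\<close> alone does not determine.\<close>

definition tent_mass :: "real \<Rightarrow> 'a::euclidean_space itself \<Rightarrow> real" where
  "tent_mass R _ = (\<integral>x. tent R (x :: 'a) \<partial>lborel)"

lemma tent_mass:
  assumes "0 < R"
  shows "(\<integral>\<^sup>+x. ennreal (tent R (x :: 'a::euclidean_space)) \<partial>lborel) = ennreal (tent_mass R TYPE('a))"
    "0 < tent_mass R TYPE('a)"
proof -
  have int: "integrable lborel (tent R :: 'a \<Rightarrow> real)"
  proof (rule integrableI_bounded_set[where A = "ball 0 R" and B = 1])
    show "emeasure lborel (ball (0::'a) R) < \<infinity>" using emeasure_lborel_ball_finite by simp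
  qed (use assms in \<open>auto simp: tent_nonneg tent_le_1 tent_eq_0\<close>)
  then show "(\<integral>\<^sup>+x. ennreal (tent R (x :: 'a)) \<partial>lborel) = ennreal (tent_mass R TYPE('a))"
    unfolding tent_mass_def by (intro nn_integral_eq_integral) (auto simp: tent_nonneg)
  have "tent_mass R TYPE('a) \<noteq> 0"
  proof
    assume "tent_mass R TYPE('a) = 0"
    then have "AE x in lborel. tent R (x :: 'a) = 0"
      unfolding tent_mass_def using int by (subst (asm) integral_nonneg_eq_0_iff_AE) (auto simp: tent_nonneg)
    then have "AE x in lborel. x \<notin> ball (0::'a) R"
      by eventually_elim (use tent_pos[OF assms] in force)
    then have "emeasure lborel (ball (0::'a) R) = 0"
      by (subst (asm) AE_iff_measurable[where N = "ball 0 R"]) auto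
    then show False using assms content_ball_pos[of R "0::'a"]
      by (simp add: measure_def)
  qed
  moreover have "0 \<le> tent_mass R TYPE('a)" unfolding tent_mass_def by (simp add: tent_nonneg)
  ultimately show "0 < tent_mass R TYPE('a)" by simp
qed

text \<open>A log-concave measure is accessible only through its mollifications; this is the form in which their
densities are used: integrating against the density is integrating the mollified test function.\<close>

lemma log_concave_measure_smoothing:
  fixes \<nu> :: "(real ^ 'n) measure"
  assumes \<nu>: "log_concave_measure \<nu>" and "0 < e"
  shows "\<exists>h. log_concave h \<and> h \<in> borel_measurable borel \<and>
    (\<exists>A b. 0 \<le> A \<and> 0 \<le> b \<and> (\<forall>x. h x \<le> A * exp (b * norm x))) \<and>
    (\<forall>\<psi>. \<psi> \<in> borel_measurable borel \<longrightarrow>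
      (\<integral>\<^sup>+x. ennreal (h x) * \<psi> x \<partial>lborel) = (\<integral>\<^sup>+x. (\<integral>\<^sup>+y. ennreal (tent e y) * \<psi> (x + y) \<partial>lborel) \<partial>\<nu>))"
proof -
  have [measurable_cong]: "sets \<nu> = sets borel" using \<nu> by (simp add: log_concave_measure_def)
  obtain h where h: "log_concave h" "h \<in> borel_measurable borel"
    and conv: "convolution \<nu> (density lborel (\<lambda>x. ennreal (tent e x))) = density lborel (\<lambda>x. ennreal (h x))"
    using \<nu> log_concave_tent[OF \<open>0 < e\<close>] continuous_on_tent compactly_supported_tent[OF \<open>0 < e\<close>]
    unfolding log_concave_measure_def by blast
  obtain h' A b where h': "log_concave h'" "h' \<in> borel_measurable borel" "0 \<le> A" "0 \<le> b"
     "AE x in lborel. h x = h' x" "\<And>x. h' x \<le> A * exp (b * norm x)"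
    using log_concave_density_growth[OF h] by blast
  note [measurable] = h(2) h'(2)
  have ident: "(\<integral>\<^sup>+x. ennreal (h' x) * \<psi> x \<partial>lborel) = (\<integral>\<^sup>+x. (\<integral>\<^sup>+y. ennreal (tent e y) * \<psi> (x + y) \<partial>lborel) \<partial>\<nu>)"
    if [measurable]: "\<psi> \<in> borel_measurable borel" for \<psi>
  proof -
    let ?D = "density lborel (\<lambda>x::real ^ 'n. ennreal (tent e x))"
    interpret D: finite_measure ?D
      by (rule finite_measureI) (simp add: emeasure_density tent_mass[OF \<open>0 < e\<close>])
    have "(\<integral>\<^sup>+x. ennreal (h' x) * \<psi> x \<partial>lborel) = (\<integral>\<^sup>+x. ennreal (h x) * \<psi> x \<partial>lborel)"
      using h'(5) by (intro nn_integral_cong_AE) (auto elim: eventually_mono)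
    also have "\<dots> = (\<integral>\<^sup>+x. \<psi> x \<partial>density lborel (\<lambda>x. ennreal (h x)))"
      by (simp add: nn_integral_density)
    also have "\<dots> = (\<integral>\<^sup>+x. \<psi> x \<partial>convolution \<nu> ?D)" by (simp only: conv)
    also have "\<dots> = (\<integral>\<^sup>+z. \<psi> (fst z + snd z) \<partial>(\<nu> \<Otimes>\<^sub>M ?D))"
      unfolding convolution_def by (subst nn_integral_distr) (auto simp: case_prod_beta')
    also have "\<dots> = (\<integral>\<^sup>+x. (\<integral>\<^sup>+y. \<psi> (x + y) \<partial>?D) \<partial>\<nu>)"
      by (subst D.nn_integral_fst[symmetric]) auto
    also have "\<dots> = (\<integral>\<^sup>+x. (\<integral>\<^sup>+y. ennreal (tent e y) * \<psi> (x + y) \<partial>lborel) \<partial>\<nu>)"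
      by (simp add: nn_integral_density)
    finally show ?thesis .
  qed
  show ?thesis using h' ident by blast
qed

section \<open>Prekopa-Leindler inequality for log-concave measures\<close>

text \<open>Mollifying with the unit tent spreads mass by at most distance \<open>1\<close>, so the mass of a ball is controlled by
the mass that the locally bounded density gives to a slightly larger ball.\<close>

lemma log_concave_measure_finite_on_bounded:
  fixes \<nu> :: "(real ^ 'n) measure"
  assumes \<nu>: "log_concave_measure \<nu>"
  shows "emeasure \<nu> (cball 0 r) < \<infinity>"
proof -
  have [measurable_cong]: "sets \<nu> = sets borel" using \<nu> by (simp add: log_concave_measure_def)
  obtain h A b where h: "h \<in> borel_measurable borel" "0 \<le> A" "0 \<le> b"
      "\<And>x. h x \<le> A * exp (b * norm x)"
    and ident: "\<And>\<psi>. \<psi> \<in> borel_measurable borel \<Longrightarrow> (\<integral>\<^sup>+x. ennreal (h x) * \<psi> x \<partial>lborel)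
       = (\<integral>\<^sup>+x. (\<integral>\<^sup>+y. ennreal (tent 1 (y :: real ^ 'n)) * \<psi> (x + y) \<partial>lborel) \<partial>\<nu>)"
    using log_concave_measure_smoothing[OF \<nu>, of 1] by auto
  let ?B = "cball (0 :: real ^ 'n) (r + 1)"
  define c where "c = tent_mass 1 TYPE(real ^ 'n)"
  have c: "(\<integral>\<^sup>+y. ennreal (tent 1 (y :: real ^ 'n)) \<partial>lborel) = ennreal c" "0 < c"
    using tent_mass[where 'a = "real ^ 'n", of 1] by (auto simp: c_def)
  have "ennreal c * emeasure \<nu> (cball 0 r)
      = (\<integral>\<^sup>+x. ennreal c * indicator (cball 0 r) x \<partial>\<nu>)"
    by (rule nn_integral_cmult_indicator[symmetric]) simp
  also have "\<dots> = (\<integral>\<^sup>+x. (\<integral>\<^sup>+y. ennreal (tent 1 (y :: real ^ 'n)) * indicator (cball 0 r) x \<partial>lborel) \<partial>\<nu>)"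
    by (simp add: nn_integral_multc c)
  also have "\<dots> \<le> (\<integral>\<^sup>+x. (\<integral>\<^sup>+y. ennreal (tent 1 (y :: real ^ 'n)) * indicator ?B (x + y) \<partial>lborel) \<partial>\<nu>)"
  proof (intro nn_integral_mono)
    fix x y :: "real ^ 'n"
    show "ennreal (tent 1 y) * indicator (cball 0 r) x \<le> ennreal (tent 1 y) * indicator ?B (x + y)"
    proof (cases "norm y < 1 \<and> x \<in> cball 0 r")
      case True
      then have "x + y \<in> ?B" using norm_triangle_ineq[of x y] by auto
      then show ?thesis using True by simp
    next
      case False
      then show ?thesis using tent_eq_0[of 1 y] by (cases "norm y < 1") (auto simp: indicator_def)
    qed
  qed
  also have "\<dots> = (\<integral>\<^sup>+x. ennreal (h x) * indicator ?B x \<partial>lborel)"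
    by (rule ident[symmetric], rule borel_measurable_indicator) simp
  also have "\<dots> \<le> (\<integral>\<^sup>+x. ennreal (A * exp (b * \<bar>r + 1\<bar>)) * indicator ?B x \<partial>lborel)"
  proof (intro nn_integral_mono)
    fix x :: "real ^ 'n"
    have "h x \<le> A * exp (b * \<bar>r + 1\<bar>)" if "x \<in> ?B"
      by (rule order.trans[OF h(4)]) (use that h in \<open>auto intro!: mult_left_mono\<close>)
    then show "ennreal (h x) * indicator ?B x \<le> ennreal (A * exp (b * \<bar>r + 1\<bar>)) * indicator ?B x"
      by (auto simp: indicator_def intro: ennreal_leI)
  qed
  also have "\<dots> = ennreal (A * exp (b * \<bar>r + 1\<bar>)) * emeasure lborel ?B"
    by (rule nn_integral_cmult_indicator) simp
  also have "\<dots> < \<infinity>"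
    using emeasure_bounded_finite[of ?B] by (simp add: ennreal_mult_less_top)
  finally show ?thesis using c by (auto simp: ennreal_mult_less_top)
qed

lemma integrable_bounded_support:
  fixes \<mu> :: "'a::euclidean_space measure" and u :: "'a \<Rightarrow> real"
  assumes [measurable_cong]: "sets \<mu> = sets borel" and fin: "emeasure \<mu> (cball 0 R) < \<infinity>"
    and u: "continuous_on UNIV u" "\<And>x. x \<notin> cball 0 R \<Longrightarrow> u x = 0"
  shows "integrable \<mu> u"
proof -
  have "compact (u ` cball 0 R)"
    using u by (intro compact_continuous_image) (auto intro: continuous_on_subset)
  then obtain C where C: "\<And>x. x \<in> cball 0 R \<Longrightarrow> norm (u x) \<le> C"
    by (metis bounded_iff compact_imp_bounded imageI)
  have [measurable]: "u \<in> borel_measurable borel" using u by (intro borel_measurable_continuous_onI)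
  show ?thesis
    by (rule integrableI_bounded_set[OF _ _ fin, where B = C]) (use C u in auto)
qed

text \<open>By uniform continuity, a small mollification changes \<open>u\<close> by at most \<open>\<eta>\<close>, and only on a ball slightly larger
than the one that supports \<open>u\<close>. The estimate is stated without division or subtraction so that it makes
sense for extended nonnegative integrals.\<close>

lemma mollification_estimate:
  fixes \<nu> :: "'a::euclidean_space measure" and u :: "'a \<Rightarrow> real"
  assumes [measurable_cong]: "sets \<nu> = sets borel"
    and u: "continuous_on UNIV u" "\<And>x. 0 \<le> u x" "\<And>x. x \<notin> cball 0 R \<Longrightarrow> u x = 0" and "0 < \<eta>"
  defines "X \<equiv> \<lambda>e. \<integral>\<^sup>+x. (\<integral>\<^sup>+y. ennreal (tent e y) * ennreal (u (x + y)) \<partial>lborel) \<partial>\<nu>"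
  shows "\<exists>d>0. \<forall>e. 0 < e \<longrightarrow> e < d \<longrightarrow>
     X e \<le> ennreal (tent_mass e TYPE('a)) * ((\<integral>\<^sup>+x. ennreal (u x) \<partial>\<nu>) + ennreal \<eta> * emeasure \<nu> (cball 0 (R + 1))) \<and>
     ennreal (tent_mass e TYPE('a)) * (\<integral>\<^sup>+x. ennreal (u x) \<partial>\<nu>)
       \<le> X e + ennreal (tent_mass e TYPE('a)) * (ennreal \<eta> * emeasure \<nu> (cball 0 (R + 1)))"
proof -
  have [measurable]: "u \<in> borel_measurable borel" using u by (intro borel_measurable_continuous_onI)
  have "uniformly_continuous_on (cball 0 (R + 2)) u"
    using u by (intro compact_uniformly_continuous) (auto intro: continuous_on_subset)
  then obtain d0 where d0: "0 < d0" "\<And>x x'. x \<in> cball 0 (R + 2) \<Longrightarrow> x' \<in> cball 0 (R + 2) \<Longrightarrow>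
      dist x' x < d0 \<Longrightarrow> dist (u x') (u x) < \<eta>"
    using \<open>0 < \<eta>\<close> unfolding uniformly_continuous_on_def by metis
  let ?B = "cball (0::'a) (R + 1)"
  have close: "\<bar>u (x + y) - u x\<bar> \<le> \<eta> * indicator ?B x" if "norm y < min d0 1" for x y
  proof (cases "x \<in> ?B")
    case True
    then have "x \<in> cball 0 (R + 2)" "x + y \<in> cball 0 (R + 2)"
      using that norm_triangle_ineq[of x y] by auto
    then have "dist (u (x + y)) (u x) < \<eta>" using that by (intro d0) (auto simp: dist_norm)
    then show ?thesis using True by (simp add: dist_real_def)
  next
    case False
    then have "x \<notin> cball 0 R" "x + y \<notin> cball 0 R"
      using that norm_triangle_ineq4[of "x + y" y] by auto
    then show ?thesis using u(3) False by simp
  qed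
  have "X e \<le> ennreal (tent_mass e TYPE('a)) * ((\<integral>\<^sup>+x. ennreal (u x) \<partial>\<nu>) + ennreal \<eta> * emeasure \<nu> ?B) \<and>
     ennreal (tent_mass e TYPE('a)) * (\<integral>\<^sup>+x. ennreal (u x) \<partial>\<nu>)
       \<le> X e + ennreal (tent_mass e TYPE('a)) * (ennreal \<eta> * emeasure \<nu> ?B)"
    if e: "0 < e" "e < min d0 1" for e
  proof
    let ?c = "ennreal (tent_mass e TYPE('a))"
    have c: "(\<integral>\<^sup>+y. ennreal (tent e (y :: 'a)) * k \<partial>lborel) = ?c * k" for k
      by (subst nn_integral_multc) (auto simp: tent_mass[OF e(1)])
    have [measurable]: "?B \<in> sets borel" by simp
    have I: "(\<integral>\<^sup>+x. ennreal \<eta> * indicator ?B x \<partial>\<nu>) = ennreal \<eta> * emeasure \<nu> ?B"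
      by (rule nn_integral_cmult_indicator) simp
    have pt: "ennreal (tent e y) * ennreal (u (x + y)) \<le> ennreal (tent e y) * (ennreal (u x) + ennreal \<eta> * indicator ?B x)"
      "ennreal (tent e y) * ennreal (u x) \<le> ennreal (tent e y) * ennreal (u (x + y)) + ennreal (tent e y) * (ennreal \<eta> * indicator ?B x)"
      for x y
    proof -
      have "ennreal (u (x + y)) \<le> ennreal (u x) + ennreal \<eta> * indicator ?B x \<and>
          ennreal (u x) \<le> ennreal (u (x + y)) + ennreal \<eta> * indicator ?B x" if "norm y < e"
      proof -
        have "ennreal \<eta> * indicator ?B x = ennreal (\<eta> * indicator ?B x)"
          using \<open>0 < \<eta>\<close> by (auto simp: indicator_def)
        then show ?thesis
          using close[of y x] that e u(2) \<open>0 < \<eta>\<close>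
          by (auto simp: ennreal_plus[symmetric] abs_le_iff simp del: ennreal_plus intro!: ennreal_leI)
      qed
      then show "ennreal (tent e y) * ennreal (u (x + y)) \<le> ennreal (tent e y) * (ennreal (u x) + ennreal \<eta> * indicator ?B x)"
        "ennreal (tent e y) * ennreal (u x) \<le> ennreal (tent e y) * ennreal (u (x + y)) + ennreal (tent e y) * (ennreal \<eta> * indicator ?B x)"
        using tent_eq_0[OF e(1), of y]
        by (cases "norm y < e"; auto simp: distrib_left[symmetric] intro!: mult_left_mono)+
    qed
    have "X e \<le> (\<integral>\<^sup>+x. (\<integral>\<^sup>+y. ennreal (tent e (y :: 'a)) * (ennreal (u x) + ennreal \<eta> * indicator ?B x) \<partial>lborel) \<partial>\<nu>)"
      unfolding X_def by (rule nn_integral_mono, rule nn_integral_mono, rule pt)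
    also have "\<dots> = ?c * ((\<integral>\<^sup>+x. ennreal (u x) \<partial>\<nu>) + ennreal \<eta> * emeasure \<nu> ?B)"
      unfolding c by (subst nn_integral_cmult, measurable, subst nn_integral_add, measurable, simp add: I)
    finally show "X e \<le> ?c * ((\<integral>\<^sup>+x. ennreal (u x) \<partial>\<nu>) + ennreal \<eta> * emeasure \<nu> ?B)" .
    have "?c * (\<integral>\<^sup>+x. ennreal (u x) \<partial>\<nu>) = (\<integral>\<^sup>+x. (\<integral>\<^sup>+y. ennreal (tent e (y :: 'a)) * ennreal (u x) \<partial>lborel) \<partial>\<nu>)"
      by (simp add: c nn_integral_cmult)
    also have "\<dots> \<le> (\<integral>\<^sup>+x. (\<integral>\<^sup>+y. ennreal (tent e y) * ennreal (u (x + y))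
         + ennreal (tent e y) * (ennreal \<eta> * indicator ?B x) \<partial>lborel) \<partial>\<nu>)"
      by (rule nn_integral_mono, rule nn_integral_mono, rule pt)
    also have "\<dots> = X e + ?c * (ennreal \<eta> * emeasure \<nu> ?B)"
    proof -
      have "(\<integral>\<^sup>+x. ?c * (ennreal \<eta> * indicator ?B x) \<partial>\<nu>) = ?c * (ennreal \<eta> * emeasure \<nu> ?B)"
        by (subst nn_integral_cmult, measurable, simp add: I)
      then show ?thesis unfolding X_def
        by (subst nn_integral_add, measurable, subst nn_integral_add, measurable, simp add: c)
    qed
    finally show "?c * (\<integral>\<^sup>+x. ennreal (u x) \<partial>\<nu>) \<le> X e + ?c * (ennreal \<eta> * emeasure \<nu> ?B)" .
  qed
  then show ?thesis using d0(1) by (intro exI[of _ "min d0 1"]) auto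
qed

lemma mollification_tendsto:
  fixes \<nu> :: "'a::euclidean_space measure" and u :: "'a \<Rightarrow> real" and h :: "nat \<Rightarrow> 'a \<Rightarrow> real"
  assumes sets: "sets \<nu> = sets borel" and fin: "\<And>r. emeasure \<nu> (cball 0 r) < \<infinity>"
    and u: "continuous_on UNIV u" "\<And>x. 0 \<le> u x" "\<And>x. x \<notin> cball 0 R \<Longrightarrow> u x = 0"
    and h: "\<And>n x. 0 \<le> h n x" "\<And>n. integrable lborel (\<lambda>x. u x * h n x)"
      "\<And>n. (\<integral>\<^sup>+x. ennreal (h n x) * ennreal (u x) \<partial>lborel)
         = (\<integral>\<^sup>+x. (\<integral>\<^sup>+y. ennreal (tent (1 / real (Suc n)) y) * ennreal (u (x + y)) \<partial>lborel) \<partial>\<nu>)"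
  shows "(\<lambda>n. (\<integral>x. u x * h n x \<partial>lborel) / tent_mass (1 / real (Suc n)) TYPE('a)) \<longlonglongrightarrow> (\<integral>x. u x \<partial>\<nu>)"
proof (rule LIMSEQ_I)
  fix r :: real assume r: "0 < r"
  define m where "m = measure \<nu> (cball 0 (R + 1))"
  have m: "emeasure \<nu> (cball 0 (R + 1)) = ennreal m" "0 \<le> m"
    using fin[of "R + 1"] by (auto simp: m_def emeasure_eq_ennreal_measure)
  define U where "U = (\<integral>x. u x \<partial>\<nu>)"
  have U: "(\<integral>\<^sup>+x. ennreal (u x) \<partial>\<nu>) = ennreal U" "0 \<le> U"
    unfolding U_def using integrable_bounded_support[OF sets fin u(1,3)] u(2)
    by (auto intro!: nn_integral_eq_integral)
  define k where "k = m + 1"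
  define \<eta> where "\<eta> = r / (2 * k)"
  have k: "0 < k" using m by (simp add: k_def)
  have \<eta>: "0 < \<eta>" using r k by (simp add: \<eta>_def)
  have "\<eta> * m \<le> \<eta> * k" using \<eta> by (simp add: k_def)
  also have "\<dots> = r / 2" using k by (simp add: \<eta>_def)
  finally have \<eta>m: "\<eta> * m < r" using r by simp
  define Y where "Y e = (\<integral>\<^sup>+x. (\<integral>\<^sup>+y. ennreal (tent e y) * ennreal (u (x + y)) \<partial>lborel) \<partial>\<nu>)" for e
  have "\<exists>d>0. \<forall>e. 0 < e \<longrightarrow> e < d \<longrightarrow>
     Y e \<le> ennreal (tent_mass e TYPE('a)) * (ennreal U + ennreal \<eta> * ennreal m) \<and>
     ennreal (tent_mass e TYPE('a)) * ennreal U \<le> Y e + ennreal (tent_mass e TYPE('a)) * (ennreal \<eta> * ennreal m)"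
    unfolding U(1)[symmetric] m(1)[symmetric] Y_def
    by (rule mollification_estimate) (use sets u \<eta> in auto)
  then obtain d where d: "0 < d" and est: "\<And>e. 0 < e \<Longrightarrow> e < d \<Longrightarrow>
     Y e \<le> ennreal (tent_mass e TYPE('a)) * (ennreal U + ennreal \<eta> * ennreal m) \<and>
     ennreal (tent_mass e TYPE('a)) * ennreal U \<le> Y e + ennreal (tent_mass e TYPE('a)) * (ennreal \<eta> * ennreal m)"
    by blast
  obtain N where N: "1 / real (Suc N) < d" using d by (metis nat_approx_posE)
  show "\<exists>N. \<forall>n\<ge>N. norm ((\<integral>x. u x * h n x \<partial>lborel) / tent_mass (1 / real (Suc n)) TYPE('a) - (\<integral>x. u x \<partial>\<nu>)) < r"
  proof (intro exI allI impI)
    fix n assume n: "N \<le> n"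
    define e where "e = 1 / real (Suc n)"
    define c where "c = tent_mass e TYPE('a)"
    define X where "X = (\<integral>x. u x * h n x \<partial>lborel)"
    have "e \<le> 1 / real (Suc N)" using n by (simp add: e_def frac_le)
    then have e: "0 < e" "e < d" using N by (auto simp: e_def)
    have c: "0 < c" using tent_mass(2)[OF e(1), where 'a = 'a] by (simp add: c_def)
    have X: "Y e = ennreal X" "0 \<le> X"
    proof -
      have "(\<integral>\<^sup>+x. ennreal (h n x) * ennreal (u x) \<partial>lborel) = (\<integral>\<^sup>+x. ennreal (u x * h n x) \<partial>lborel)"
        using u(2) h(1) by (simp add: ennreal_mult mult.commute)
      also have "\<dots> = ennreal X"
        unfolding X_def using h u(2) by (intro nn_integral_eq_integral) auto
      finally show "Y e = ennreal X" unfolding Y_def e_def h(3)[symmetric] .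
      show "0 \<le> X" unfolding X_def using h(1) u(2) by simp
    qed
    have "0 \<le> \<eta> * m" using \<eta> m by simp
    then have eqs: "ennreal (c * (U + \<eta> * m)) = ennreal c * (ennreal U + ennreal \<eta> * ennreal m)"
      "ennreal (c * U) = ennreal c * ennreal U"
      "ennreal (X + c * (\<eta> * m)) = ennreal X + ennreal c * (ennreal \<eta> * ennreal m)"
      using c \<eta> m(2) U(2) X(2) by (simp_all add: ennreal_mult)
    have "ennreal X \<le> ennreal (c * (U + \<eta> * m))" "ennreal (c * U) \<le> ennreal (X + c * (\<eta> * m))"
      using est[OF e] unfolding eqs c_def[symmetric] X(1) by auto
    then have "X \<le> c * (U + \<eta> * m)" "c * U \<le> X + c * (\<eta> * m)"
      using c \<open>0 \<le> \<eta> * m\<close> U(2) X(2) by (simp_all add: ennreal_le_iff del: ennreal_plus)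
    then have "X / c \<le> U + \<eta> * m" "U - \<eta> * m \<le> X / c"
      using c by (auto simp: field_simps)
    then show "norm ((\<integral>x. u x * h n x \<partial>lborel) / tent_mass (1 / real (Suc n)) TYPE('a) - (\<integral>x. u x \<partial>\<nu>)) < r"
      using \<eta>m unfolding X_def[symmetric] e_def[symmetric] c_def[symmetric] U_def[symmetric] by auto
  qed
qed

text \<open>Multiplying \<open>u\<close>, \<open>v\<close>, \<open>w\<close> by a log-concave density preserves the Prekopa-Leindler hypothesis, so the
inequality holds for every mollification of \<open>\<nu>\<close>; the normalizing constants cancel because \<open>t + s = 1\<close>. Continuity
and compact support of the three functions allow the mollification to be removed. In this form
singular measures, for instance those carried by a subspace, are covered.\<close>

lemma prekopa_leindler_log_concave_measure:
  fixes \<nu> :: "(real ^ 'n) measure" and u v w :: "real ^ 'n \<Rightarrow> real"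
  assumes \<nu>: "log_concave_measure \<nu>" and ts: "0 < t" "0 < s" "t + s = 1"
    and u: "continuous_on UNIV u" "\<And>x. 0 \<le> u x" "\<And>x. x \<notin> cball 0 R \<Longrightarrow> u x = 0"
    and v: "continuous_on UNIV v" "\<And>x. 0 \<le> v x" "\<And>x. x \<notin> cball 0 R \<Longrightarrow> v x = 0"
    and w: "continuous_on UNIV w" "\<And>x. 0 \<le> w x" "\<And>x. x \<notin> cball 0 R \<Longrightarrow> w x = 0"
    and PL: "\<And>x y. u x powr t * v y powr s \<le> w (t *\<^sub>R x + s *\<^sub>R y)"
  shows "(\<integral>x. u x \<partial>\<nu>) powr t * (\<integral>x. v x \<partial>\<nu>) powr s \<le> (\<integral>x. w x \<partial>\<nu>)"
proof -
  have sets: "sets \<nu> = sets borel" using \<nu> by (simp add: log_concave_measure_def)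
  note fin = log_concave_measure_finite_on_bounded[OF \<nu>]
  have "\<forall>n. \<exists>h. log_concave h \<and> h \<in> borel_measurable borel \<and>
     (\<exists>A b. 0 \<le> A \<and> 0 \<le> b \<and> (\<forall>x. h x \<le> A * exp (b * norm x))) \<and>
    (\<forall>\<psi>. \<psi> \<in> borel_measurable borel \<longrightarrow>
      (\<integral>\<^sup>+x. ennreal (h x) * \<psi> x \<partial>lborel) =
      (\<integral>\<^sup>+x. (\<integral>\<^sup>+y. ennreal (tent (1 / real (Suc n)) y) * \<psi> (x + y) \<partial>lborel) \<partial>\<nu>))"
    by (intro allI log_concave_measure_smoothing[OF \<nu>]) simp
  from choice[OF this] obtain h where H: "\<forall>n. log_concave (h n) \<and> h n \<in> borel_measurable borel \<and>
     (\<exists>A b. 0 \<le> A \<and> 0 \<le> b \<and> (\<forall>x. h n x \<le> A * exp (b * norm x))) \<and>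
    (\<forall>\<psi>. \<psi> \<in> borel_measurable borel \<longrightarrow>
      (\<integral>\<^sup>+x. ennreal (h n x) * \<psi> x \<partial>lborel) =
      (\<integral>\<^sup>+x. (\<integral>\<^sup>+y. ennreal (tent (1 / real (Suc n)) y) * \<psi> (x + y) \<partial>lborel) \<partial>\<nu>))" ..
  have lc: "log_concave (h n)" and [measurable]: "h n \<in> borel_measurable borel"
    and growth: "\<exists>A b. 0 \<le> A \<and> 0 \<le> b \<and> (\<forall>x. h n x \<le> A * exp (b * norm x))" for n
    using H by simp_all
  have ident: "(\<integral>\<^sup>+x. ennreal (h n x) * \<psi> x \<partial>lborel) =
      (\<integral>\<^sup>+x. (\<integral>\<^sup>+y. ennreal (tent (1 / real (Suc n)) y) * \<psi> (x + y) \<partial>lborel) \<partial>\<nu>)"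
    if "\<psi> \<in> borel_measurable borel" for n \<psi>
    using H that by simp
  have h0: "0 \<le> h n x" for n x using lc[of n] by (simp add: log_concave_def)
  have hlc: "h n x powr t * h n y powr s \<le> h n (t *\<^sub>R x + s *\<^sub>R y)" for n x y
    using lc[of n] ts unfolding log_concave_def by (meson less_imp_le)
  define adm where "adm f \<longleftrightarrow> continuous_on UNIV f \<and> (\<forall>x. 0 \<le> f x) \<and> (\<forall>x. x \<notin> cball 0 R \<longrightarrow> f x = 0)"
    for f :: "real ^ 'n \<Rightarrow> real"
  have adm: "adm u" "adm v" "adm w" using u v w by (auto simp: adm_def)
  have admD: "continuous_on UNIV f" "\<And>x. 0 \<le> f x" "\<And>x. x \<notin> cball 0 R \<Longrightarrow> f x = 0" if "adm f" for f
    using that by (auto simp: adm_def)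
  have bound: "\<exists>C\<ge>0. \<forall>x. f x * h n x \<le> C * indicator (cball 0 R) x"
    if adm: "adm f" for f n
  proof -
    note f = admD[OF adm]
    obtain A b where Ab: "0 \<le> A" "0 \<le> b" "\<And>x. h n x \<le> A * exp (b * norm x)" using growth by blast
    have "compact (f ` cball 0 R)"
      using f by (intro compact_continuous_image) (auto intro: continuous_on_subset)
    then obtain C where C: "\<And>x. x \<in> cball 0 R \<Longrightarrow> norm (f x) \<le> C"
      by (metis bounded_iff compact_imp_bounded imageI)
    have "f x * h n x \<le> (\<bar>C\<bar> * (A * exp (b * \<bar>R\<bar>))) * indicator (cball 0 R) x" for x
    proof (cases "x \<in> cball 0 R")
      case True
      have "h n x \<le> A * exp (b * \<bar>R\<bar>)"
        by (rule order.trans[OF Ab(3)]) (use True Ab in \<open>auto intro!: mult_left_mono\<close>)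
      then have "f x * h n x \<le> \<bar>C\<bar> * (A * exp (b * \<bar>R\<bar>))"
        using C[OF True] f(2)[of x] h0[of n x] by (intro mult_mono) auto
      then show ?thesis using True by simp
    qed (use f in auto)
    then show ?thesis using Ab by (intro exI[of _ "\<bar>C\<bar> * (A * exp (b * \<bar>R\<bar>))"]) auto
  qed
  have meas: "f \<in> borel_measurable borel" if "continuous_on UNIV f" for f :: "real ^ 'n \<Rightarrow> real"
    using that by (rule borel_measurable_continuous_onI)
  have [measurable]: "u \<in> borel_measurable borel" "v \<in> borel_measurable borel" "w \<in> borel_measurable borel"
    using u v w by (auto intro: meas)
  define c where "c n = tent_mass (1 / real (Suc n)) TYPE(real ^ 'n)" for n
  have c: "0 < c n" for n using tent_mass(2)[where 'a = "real ^ 'n"] by (simp add: c_def)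
  have lim: "(\<lambda>n. (\<integral>x. f x * h n x \<partial>lborel) / c n) \<longlonglongrightarrow> (\<integral>x. f x \<partial>\<nu>)"
    if adm: "adm f" for f
    unfolding c_def
  proof (rule mollification_tendsto[OF sets fin])
    note f = admD[OF adm]
    show "continuous_on UNIV f" "0 \<le> f x" "x \<notin> cball 0 R \<Longrightarrow> f x = 0" "0 \<le> h n x" for x n
      using f h0 by auto
    fix n
    obtain C where C: "0 \<le> C" "\<And>x. f x * h n x \<le> C * indicator (cball 0 R) x" using bound[OF adm] by blast
    note [measurable] = meas[OF f(1)]
    show "integrable lborel (\<lambda>x. f x * h n x)"
    proof (rule integrableI_bounded_set[where A = "cball 0 R" and B = C])
      show "emeasure lborel (cball (0 :: real ^ 'n) R) < \<infinity>" by (intro emeasure_bounded_finite) simp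
      show "AE x in lborel. x \<in> cball 0 R \<longrightarrow> norm (f x * h n x) \<le> C"
        using C f(2) h0 by (intro AE_I2 impI) (metis abs_of_nonneg indicator_simps(1) mult.right_neutral mult_nonneg_nonneg real_norm_def)
    qed (use f(3) in auto)
    show "(\<integral>\<^sup>+x. ennreal (h n x) * ennreal (f x) \<partial>lborel)
       = (\<integral>\<^sup>+x. (\<integral>\<^sup>+y. ennreal (tent (1 / real (Suc n)) y) * ennreal (f (x + y)) \<partial>lborel) \<partial>\<nu>)"
      by (rule ident[of "\<lambda>x. ennreal (f x)"]) measurable
  qed
  have step: "((\<integral>x. u x * h n x \<partial>lborel) / c n) powr t * ((\<integral>x. v x * h n x \<partial>lborel) / c n) powr s
      \<le> (\<integral>x. w x * h n x \<partial>lborel) / c n" for n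
  proof -
    obtain Cu Cv Cw where C: "0 \<le> Cu" "\<And>x. u x * h n x \<le> Cu * indicator (cball 0 R) x"
       "0 \<le> Cv" "\<And>x. v x * h n x \<le> Cv * indicator (cball 0 R) x"
       "0 \<le> Cw" "\<And>x. w x * h n x \<le> Cw * indicator (cball 0 R) x"
      using bound[OF adm(1)] bound[OF adm(2)] bound[OF adm(3)] by metis
    have "(\<integral>x. u x * h n x \<partial>lborel) powr t * (\<integral>x. v x * h n x \<partial>lborel) powr s
      \<le> (\<integral>x. w x * h n x \<partial>lborel)"
    proof (rule prekopa_leindler[OF ts, where R = R and C = "Cu + Cv + Cw"])
      fix x y :: "real ^ 'n"
      have le: "K * indicator (cball 0 R) x \<le> (Cu + Cv + Cw) * (indicator (cball 0 R) x :: real)"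
        if "K \<le> Cu + Cv + Cw" for K using that by (intro mult_right_mono) auto
      show "u x * h n x \<le> (Cu + Cv + Cw) * indicator (cball 0 R) x"
        by (rule order.trans[OF C(2) le]) (use C(1,3,5) in linarith)
      show "v x * h n x \<le> (Cu + Cv + Cw) * indicator (cball 0 R) x"
        by (rule order.trans[OF C(4) le]) (use C(1,3,5) in linarith)
      show "w x * h n x \<le> (Cu + Cv + Cw) * indicator (cball 0 R) x"
        by (rule order.trans[OF C(6) le]) (use C(1,3,5) in linarith)
      have "(u x * h n x) powr t * (v y * h n y) powr s
          = (u x powr t * v y powr s) * (h n x powr t * h n y powr s)"
        using u v h0 by (simp add: powr_mult)
      also have "\<dots> \<le> w (t *\<^sub>R x + s *\<^sub>R y) * h n (t *\<^sub>R x + s *\<^sub>R y)"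
        by (intro mult_mono PL hlc w) auto
      finally show "(u x * h n x) powr t * (v y * h n y) powr s
          \<le> w (t *\<^sub>R x + s *\<^sub>R y) * h n (t *\<^sub>R x + s *\<^sub>R y)" .
    qed (use u v w h0 in auto)
    moreover have "c n powr t * c n powr s = c n" using c[of n] ts by (simp add: powr_add[symmetric])
    ultimately show ?thesis
      using c[of n] u v w h0 by (simp add: powr_divide divide_right_mono)
  qed
  show ?thesis
  proof (rule LIMSEQ_le)
    show "(\<lambda>n. (\<integral>x. w x * h n x \<partial>lborel) / c n) \<longlonglongrightarrow> (\<integral>x. w x \<partial>\<nu>)" by (rule lim[OF adm(3)])
    show "(\<lambda>n. ((\<integral>x. u x * h n x \<partial>lborel) / c n) powr t * ((\<integral>x. v x * h n x \<partial>lborel) / c n) powr s)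
       \<longlonglongrightarrow> (\<integral>x. u x \<partial>\<nu>) powr t * (\<integral>x. v x \<partial>\<nu>) powr s"
      using ts u v h0 c by (intro tendsto_mult tendsto_powr' lim adm tendsto_const) (auto simp: less_imp_le)
  qed (use step in auto)
qed

section \<open>Finiteness of super log-concave measures\<close>

lemma nn_integral_gaussian_finite:
  assumes k: "0 < k"
  shows "(\<integral>\<^sup>+x. ennreal (exp (- k * (norm (x :: 'a::euclidean_space))\<^sup>2)) \<partial>lborel) < \<infinity>"
proof -
  define \<sigma> where "\<sigma> = sqrt (1 / (2 * k))"
  have \<sigma>: "0 < \<sigma>" "2 * \<sigma>\<^sup>2 = 1 / k" using k by (auto simp: \<sigma>_def)
  have one: "(\<integral>\<^sup>+x. ennreal (exp (- k * x\<^sup>2)) \<partial>lborel) < \<infinity>"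
  proof -
    have "exp (- k * x\<^sup>2) = sqrt (2 * pi * \<sigma>\<^sup>2) * normal_density 0 \<sigma> x" for x
      using \<sigma> k by (simp add: normal_density_def)
    moreover have "integrable lborel (\<lambda>x. sqrt (2 * pi * \<sigma>\<^sup>2) * normal_density 0 \<sigma> x)"
      using \<sigma> by (intro integrable_mult_right integrable_normal_density)
    ultimately have "integrable lborel (\<lambda>x. exp (- k * x\<^sup>2))" by simp
    then show ?thesis by (subst nn_integral_eq_integral) auto
  qed
  have "ennreal (exp (- k * (norm x)\<^sup>2)) = (\<Prod>b\<in>Basis. ennreal (exp (- k * (x \<bullet> b)\<^sup>2)))" for x :: 'a
  proof -
    have "(norm x)\<^sup>2 = (\<Sum>b\<in>Basis. (x \<bullet> b)\<^sup>2)"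
      unfolding power2_norm_eq_inner by (subst euclidean_inner) (simp add: power2_eq_square)
    then have "exp (- k * (norm x)\<^sup>2) = (\<Prod>b\<in>Basis. exp (- k * (x \<bullet> b)\<^sup>2))"
      by (simp add: exp_sum[symmetric] sum_distrib_left sum_negf)
    then show ?thesis by (simp add: prod_ennreal)
  qed
  then have "(\<integral>\<^sup>+x. ennreal (exp (- k * (norm (x :: 'a))\<^sup>2)) \<partial>lborel)
     = (\<integral>\<^sup>+x. (\<Prod>b\<in>Basis. ennreal (exp (- k * ((x :: 'a) \<bullet> b)\<^sup>2))) \<partial>lborel)"
    by simp
  also have "\<dots> = (\<Prod>b\<in>(Basis :: 'a set). (\<integral>\<^sup>+x. ennreal (exp (- k * x\<^sup>2)) \<partial>lborel))"
    by (rule nn_integral_lborel_prod) auto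
  also have "\<dots> < \<infinity>"
    using one by (simp add: power_less_top_ennreal)
  finally show ?thesis .
qed

text \<open>The measure \<open>\<rho>\<close> is \<open>\<nu>\<close> weighted with a Gaussian, and after mollification \<open>\<nu>\<close> has a density of at most
exponential growth, against which any Gaussian is integrable. Mollifying costs a factor \<open>2\<close> in the
Gaussian exponent, by the parallelogram law. Finiteness matters: without it both the positive and
the negative part of the entropy could have infinite integral.\<close>

lemma finite_measure_super_log_concave:
  fixes \<rho> :: "(real ^ 'n) measure"
  assumes \<alpha>: "0 < \<alpha>" and slc: "super_log_concave_measure \<alpha> \<rho>"
  shows "finite_measure \<rho>"
proof (rule finite_measureI)
  define \<nu> where "\<nu> = density \<rho> (\<lambda>x. ennreal (exp (\<alpha> / 2 * (norm x)\<^sup>2)))"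
  have sets_\<rho>[measurable_cong]: "sets \<rho> = sets borel" and \<nu>: "log_concave_measure \<nu>"
    using slc by (auto simp: super_log_concave_measure_def \<nu>_def)
  have [measurable_cong]: "sets \<nu> = sets borel" by (simp add: \<nu>_def sets_\<rho>)
  obtain h A b where h: "h \<in> borel_measurable borel" "0 \<le> A" "0 \<le> b"
      "\<And>x. h x \<le> A * exp (b * norm x)"
    and ident: "\<And>\<psi>. \<psi> \<in> borel_measurable borel \<Longrightarrow> (\<integral>\<^sup>+x. ennreal (h x) * \<psi> x \<partial>lborel)
       = (\<integral>\<^sup>+x. (\<integral>\<^sup>+y. ennreal (tent 1 (y :: real ^ 'n)) * \<psi> (x + y) \<partial>lborel) \<partial>\<nu>)"
    using log_concave_measure_smoothing[OF \<nu>, of 1] by auto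
  define c where "c = tent_mass 1 TYPE(real ^ 'n)"
  have c: "(\<integral>\<^sup>+y. ennreal (tent 1 (y :: real ^ 'n)) \<partial>lborel) = ennreal c" "0 < c"
    using tent_mass[where 'a = "real ^ 'n", of 1] by (auto simp: c_def)
  let ?K = "ennreal (exp (- (\<alpha> / 2)))"
  have "emeasure \<rho> (space \<rho>) = (\<integral>\<^sup>+x. 1 \<partial>\<rho>)" by simp
  also have "\<dots> = (\<integral>\<^sup>+x. ennreal (exp (\<alpha> / 2 * (norm x)\<^sup>2)) * ennreal (exp (- (\<alpha> / 2) * (norm x)\<^sup>2)) \<partial>\<rho>)"
    by (simp add: ennreal_mult[symmetric] exp_add[symmetric])
  also have "\<dots> = (\<integral>\<^sup>+x. ennreal (exp (- (\<alpha> / 2) * (norm x)\<^sup>2)) \<partial>\<nu>)"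
    unfolding \<nu>_def by (subst nn_integral_density) auto
  finally have mass: "emeasure \<rho> (space \<rho>) = (\<integral>\<^sup>+x. ennreal (exp (- (\<alpha> / 2) * (norm x)\<^sup>2)) \<partial>\<nu>)" .
  have "?K * ennreal c * emeasure \<rho> (space \<rho>)
      = (\<integral>\<^sup>+x. ennreal c * (?K * ennreal (exp (- (\<alpha> / 2) * (norm x)\<^sup>2))) \<partial>\<nu>)"
    unfolding mass by (simp add: nn_integral_cmult ac_simps)
  also have "\<dots> = (\<integral>\<^sup>+x. (\<integral>\<^sup>+y. ennreal (tent 1 (y :: real ^ 'n)) *
       (?K * ennreal (exp (- (\<alpha> / 2) * (norm x)\<^sup>2))) \<partial>lborel) \<partial>\<nu>)"
    by (subst nn_integral_multc) (auto simp: c)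
  also have "\<dots> \<le> (\<integral>\<^sup>+x. (\<integral>\<^sup>+y. ennreal (tent 1 (y :: real ^ 'n)) *
       ennreal (exp (- (\<alpha> / 4) * (norm (x + y))\<^sup>2)) \<partial>lborel) \<partial>\<nu>)"
  proof (intro nn_integral_mono)
    fix x y :: "real ^ 'n"
    show "ennreal (tent 1 y) * (?K * ennreal (exp (- (\<alpha> / 2) * (norm x)\<^sup>2)))
       \<le> ennreal (tent 1 y) * ennreal (exp (- (\<alpha> / 4) * (norm (x + y))\<^sup>2))"
    proof (cases "norm y < 1")
      case True
      have "(norm (x + y))\<^sup>2 + (norm (x - y))\<^sup>2 = 2 * (norm x)\<^sup>2 + 2 * (norm y)\<^sup>2"
        by (simp add: power2_norm_eq_inner inner_add inner_diff inner_commute)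
      moreover have "(norm y)\<^sup>2 \<le> 1" using True by (simp add: power_le_one)
      moreover have "0 \<le> (norm (x - y))\<^sup>2" by simp
      ultimately have "(norm (x + y))\<^sup>2 \<le> 2 * (norm x)\<^sup>2 + 2" by linarith
      then have "\<alpha> / 4 * (norm (x + y))\<^sup>2 \<le> \<alpha> / 4 * (2 * (norm x)\<^sup>2 + 2)"
        using \<alpha> by (intro mult_left_mono) auto
      then have "exp (- (\<alpha> / 2)) * exp (- (\<alpha> / 2) * (norm x)\<^sup>2) \<le> exp (- (\<alpha> / 4) * (norm (x + y))\<^sup>2)"
        by (simp add: exp_add[symmetric] algebra_simps)
      then show ?thesis by (intro mult_left_mono) (auto simp: ennreal_mult[symmetric] intro: ennreal_leI)
    qed (simp add: tent_eq_0)
  qed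
  also have "\<dots> = (\<integral>\<^sup>+z. ennreal (h z) * ennreal (exp (- (\<alpha> / 4) * (norm z)\<^sup>2)) \<partial>lborel)"
    by (rule ident[of "\<lambda>z. ennreal (exp (- (\<alpha> / 4) * (norm z)\<^sup>2))", symmetric]) measurable
  also have "\<dots> \<le> (\<integral>\<^sup>+z. ennreal (A * exp (2 * b\<^sup>2 / \<alpha>)) * ennreal (exp (- (\<alpha> / 8) * (norm (z :: real ^ 'n))\<^sup>2)) \<partial>lborel)"
  proof (intro nn_integral_mono)
    fix z :: "real ^ 'n"
    have "0 \<le> \<alpha> / 8 * (norm z - 4 * b / \<alpha>)\<^sup>2" using \<alpha> by simp
    also have "\<dots> = \<alpha> / 8 * (norm z)\<^sup>2 - b * norm z + 2 * b\<^sup>2 / \<alpha>"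
      using \<alpha> by (simp add: power2_diff field_simps power2_eq_square)
    finally have "b * norm z + - (\<alpha> / 4) * (norm z)\<^sup>2 \<le> 2 * b\<^sup>2 / \<alpha> + - (\<alpha> / 8) * (norm z)\<^sup>2"
      by simp
    then have "exp (b * norm z) * exp (- (\<alpha> / 4) * (norm z)\<^sup>2) \<le> exp (2 * b\<^sup>2 / \<alpha>) * exp (- (\<alpha> / 8) * (norm z)\<^sup>2)"
      unfolding exp_add[symmetric] by (simp only: exp_le_cancel_iff)
    then have "A * (exp (b * norm z) * exp (- (\<alpha> / 4) * (norm z)\<^sup>2))
       \<le> A * (exp (2 * b\<^sup>2 / \<alpha>) * exp (- (\<alpha> / 8) * (norm z)\<^sup>2))"
      using h(2) by (rule mult_left_mono)
    moreover have "h z * exp (- (\<alpha> / 4) * (norm z)\<^sup>2) \<le> A * exp (b * norm z) * exp (- (\<alpha> / 4) * (norm z)\<^sup>2)"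
      using h(4) by (intro mult_right_mono) auto
    ultimately have "h z * exp (- (\<alpha> / 4) * (norm z)\<^sup>2) \<le> A * exp (2 * b\<^sup>2 / \<alpha>) * exp (- (\<alpha> / 8) * (norm z)\<^sup>2)"
      by (simp only: mult.assoc)
    then show "ennreal (h z) * ennreal (exp (- (\<alpha> / 4) * (norm z)\<^sup>2))
       \<le> ennreal (A * exp (2 * b\<^sup>2 / \<alpha>)) * ennreal (exp (- (\<alpha> / 8) * (norm z)\<^sup>2))"
      using h(2) by (simp only: ennreal_mult''[symmetric] exp_ge_zero) (rule ennreal_leI)
  qed
  also have "\<dots> = ennreal (A * exp (2 * b\<^sup>2 / \<alpha>)) * (\<integral>\<^sup>+z. ennreal (exp (- (\<alpha> / 8) * (norm (z :: real ^ 'n))\<^sup>2)) \<partial>lborel)"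
    by (rule nn_integral_cmult) measurable
  also have "\<dots> < \<infinity>"
    using nn_integral_gaussian_finite[of "\<alpha> / 8", where 'a = "real ^ 'n"] \<alpha>
    by (simp add: ennreal_mult_less_top)
  finally have "ennreal (exp (- (\<alpha> / 2)) * c) * emeasure \<rho> (space \<rho>) < \<infinity>"
    using c(2) by (simp add: ennreal_mult)
  then show "emeasure \<rho> (space \<rho>) \<noteq> \<infinity>"
    using c(2) by (auto simp: ennreal_mult_less_top)
qed

section \<open>From Prekopa-Leindler to a local logarithmic Sobolev inequality\<close>

lemma gradient_mean_value:
  fixes g :: "'a::euclidean_space \<Rightarrow> real"
  assumes S: "convex S" "x \<in> S" "z \<in> S" and g: "\<And>x. x \<in> S \<Longrightarrow> GDERIV g x :> G x"
  shows "\<exists>\<tau>. 0 \<le> \<tau> \<and> \<tau> \<le> 1 \<and> z + \<tau> *\<^sub>R (x - z) \<in> S \<and> g x - g z = (x - z) \<bullet> G (z + \<tau> *\<^sub>R (x - z))"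
proof -
  have seg: "z + \<tau> *\<^sub>R (x - z) \<in> S" if "0 \<le> \<tau>" "\<tau> \<le> 1" for \<tau>
  proof -
    have "z + \<tau> *\<^sub>R (x - z) = (1 - \<tau>) *\<^sub>R z + \<tau> *\<^sub>R x" by (simp add: algebra_simps)
    then show ?thesis using S that by (simp add: convex_alt)
  qed
  have "\<exists>\<tau>>0. \<tau> < 1 \<and> g (z + 1 *\<^sub>R (x - z)) - g (z + 0 *\<^sub>R (x - z))
     = (1 - 0) * ((x - z) \<bullet> G (z + \<tau> *\<^sub>R (x - z)))"
  proof (rule MVT2)
    fix \<tau> :: real assume "0 \<le> \<tau>" "\<tau> \<le> 1"
    then have "(g has_derivative (\<lambda>h. h \<bullet> G (z + \<tau> *\<^sub>R (x - z)))) (at (z + \<tau> *\<^sub>R (x - z)))"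
      using g[OF seg] by (simp add: gderiv_def)
    moreover have "((\<lambda>\<tau>. z + \<tau> *\<^sub>R (x - z)) has_derivative (\<lambda>\<tau>. \<tau> *\<^sub>R (x - z))) (at \<tau>)"
      by (auto intro!: derivative_eq_intros)
    ultimately have "((\<lambda>\<tau>. g (z + \<tau> *\<^sub>R (x - z))) has_derivative
        (\<lambda>h. (h *\<^sub>R (x - z)) \<bullet> G (z + \<tau> *\<^sub>R (x - z)))) (at \<tau>)"
      by (rule has_derivative_compose[rotated])
    then show "((\<lambda>\<tau>. g (z + \<tau> *\<^sub>R (x - z))) has_real_derivative (x - z) \<bullet> G (z + \<tau> *\<^sub>R (x - z))) (at \<tau>)"
      by (rule has_derivative_imp_has_field_derivative) simp
  qed simp
  then obtain \<tau> where "0 < \<tau>" "\<tau> < 1"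
      "g (z + 1 *\<^sub>R (x - z)) - g (z + 0 *\<^sub>R (x - z)) = (1 - 0) * ((x - z) \<bullet> G (z + \<tau> *\<^sub>R (x - z)))"
    by blast
  then show ?thesis using seg[of \<tau>] by (intro exI[of _ \<tau>]) simp
qed

text \<open>A first-order Taylor bound for functions that are merely continuously differentiable. Close to the
diagonal, uniform continuity of the gradient makes the error at most \<open>\<epsilon>\<close> times the distance; away from it,
boundedness of the gradient can be charged to the quadratic term. The shape of the bound is chosen so
that the Gaussian gain in the Prekopa-Leindler argument absorbs the quadratic term.\<close>

lemma first_order_upper_bound:
  fixes g :: "'a::euclidean_space \<Rightarrow> real"
  assumes S: "convex S" "compact S" and g: "\<And>x. x \<in> S \<Longrightarrow> GDERIV g x :> G x"
    and G: "continuous_on S G" and "0 < \<epsilon>"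
  shows "\<exists>L\<ge>0. \<forall>x\<in>S. \<forall>z\<in>S. g x \<le> g z + (norm (G z) + \<epsilon>) * norm (x - z) + L * (norm (x - z))\<^sup>2"
proof -
  obtain d where d: "0 < d" "\<And>x y. x \<in> S \<Longrightarrow> y \<in> S \<Longrightarrow> dist y x < d \<Longrightarrow> dist (G y) (G x) < \<epsilon>"
    using compact_uniformly_continuous[OF G S(2)] \<open>0 < \<epsilon>\<close> unfolding uniformly_continuous_on_def by metis
  have "compact (G ` S)" using G S by (intro compact_continuous_image)
  then obtain M where M: "\<And>x. x \<in> S \<Longrightarrow> norm (G x) \<le> M"
    by (metis bounded_iff compact_imp_bounded imageI)
  have "g x \<le> g z + (norm (G z) + \<epsilon>) * norm (x - z) + (\<bar>M\<bar> / d) * (norm (x - z))\<^sup>2"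
    if xz: "x \<in> S" "z \<in> S" for x z
  proof -
    obtain \<tau> where \<tau>: "0 \<le> \<tau>" "\<tau> \<le> 1" "z + \<tau> *\<^sub>R (x - z) \<in> S"
       "g x - g z = (x - z) \<bullet> G (z + \<tau> *\<^sub>R (x - z))"
      using gradient_mean_value[OF S(1) xz g] by blast
    let ?y = "z + \<tau> *\<^sub>R (x - z)" and ?r = "norm (x - z)"
    have le: "g x - g z \<le> ?r * norm (G ?y)"
      unfolding \<tau>(4) by (rule norm_cauchy_schwarz)
    show ?thesis
    proof (cases "?r < d")
      case True
      have "dist ?y z = \<tau> * ?r" using \<tau> by (simp add: dist_norm)
      also have "\<dots> \<le> 1 * ?r" using \<tau> by (intro mult_right_mono) auto
      finally have "dist (G ?y) (G z) < \<epsilon>" using True by (intro d xz \<tau>) auto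
      then have "norm (G ?y) \<le> norm (G z) + \<epsilon>"
        using norm_triangle_sub[of "G ?y" "G z"] by (simp add: dist_norm)
      then have "?r * norm (G ?y) \<le> ?r * (norm (G z) + \<epsilon>)" by (intro mult_left_mono) auto
      moreover have "0 \<le> (\<bar>M\<bar> / d) * ?r\<^sup>2" using d by simp
      ultimately show ?thesis using le by (simp add: mult.commute)
    next
      case False
      have "?r * norm (G ?y) \<le> ?r * \<bar>M\<bar>" using M[OF \<tau>(3)] by (intro mult_left_mono) auto
      also have "\<dots> = (\<bar>M\<bar> / d) * (d * ?r)" using d by simp
      also have "\<dots> \<le> (\<bar>M\<bar> / d) * (?r * ?r)" using False d by (intro mult_left_mono mult_right_mono) auto
      finally have "?r * norm (G ?y) \<le> (\<bar>M\<bar> / d) * ?r\<^sup>2" by (simp add: power2_eq_square)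
      moreover have "0 \<le> (norm (G z) + \<epsilon>) * ?r" using \<open>0 < \<epsilon>\<close> by simp
      ultimately show ?thesis using le by simp
    qed
  qed
  then show ?thesis using d by (intro exI[of _ "\<bar>M\<bar> / d"]) auto
qed

lemma weighted_square_norm_identity:
  fixes x y :: "'a::real_inner"
  assumes "t + s = 1"
  shows "t * (norm x)\<^sup>2 + s * (norm y)\<^sup>2 = (norm (t *\<^sub>R x + s *\<^sub>R y))\<^sup>2 + t * s * (norm (x - y))\<^sup>2"
proof -
  have t: "t = 1 - s" using assms by simp
  show ?thesis unfolding t power2_norm_eq_inner
    by (simp add: inner_add inner_diff inner_commute algebra_simps power2_eq_square)
qed

lemma quadratic_upper_bound:
  fixes p c r :: real
  assumes "0 < c"
  shows "p * r - c * r\<^sup>2 \<le> p\<^sup>2 / (4 * c)"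
proof -
  have "0 \<le> c * (r - p / (2 * c))\<^sup>2" using assms by simp
  also have "\<dots> = c * r\<^sup>2 - p * r + p\<^sup>2 / (4 * c)"
    using assms by (simp add: power2_diff power_divide field_simps power2_eq_square)
  finally show ?thesis by simp
qed

text \<open>Both sides of the assumed inequality equal \<open>I\<close> at \<open>s = 0\<close>. Comparing their right derivatives there yields the
claim; the entropy is the derivative of the power mean on the left.\<close>

lemma entropy_bound_of_power_bounds:
  fixes I J P m C c L s0 :: real
  assumes I: "0 < I" and m: "0 < m" and c: "0 < c" and s0: "0 < s0"
    and bound: "\<And>s. 0 < s \<Longrightarrow> s < s0 \<Longrightarrow> s < 1 \<Longrightarrow> 0 < I + s / (1 - s) * J \<Longrightarrow>
       (I + s / (1 - s) * J) powr (1 - s) * m powr s \<le> I + s / (c * (1 - s) - L * s) * P + s\<^sup>2 * C"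
  shows "J - I * ln (I / m) \<le> P / c"
proof (rule ccontr)
  assume "\<not> ?thesis"
  then have neg: "P / c - (J - I * ln (I / m)) < 0" by simp
  define F where "F s = I + s / (c * (1 - s) - L * s) * P + s\<^sup>2 * C
     - exp ((1 - s) * ln (I + s / (1 - s) * J) + s * ln m)" for s
  have "(F has_real_derivative P / c - (J - I * ln (I / m))) (at 0)"
    unfolding F_def[abs_def] using I m c
    by (auto intro!: derivative_eq_intros simp: ln_div field_simps)
  from DERIV_neg_dec_right[OF this neg] obtain d where d: "0 < d" "\<And>h. 0 < h \<Longrightarrow> h < d \<Longrightarrow> F h < F 0"
    by auto
  have "((\<lambda>s. I + s / (1 - s) * J) \<longlongrightarrow> I + 0 / (1 - 0) * J) (at_right 0)"
    by (intro tendsto_intros) auto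
  then have "\<forall>\<^sub>F s in at_right 0. 0 < I + s / (1 - s) * J"
    using I by (intro order_tendstoD(1)) auto
  moreover have "\<forall>\<^sub>F s in at_right 0. s \<in> {0<..<min (min d s0) 1}"
    using d s0 by (intro eventually_at_right_real) auto
  ultimately have "\<forall>\<^sub>F s in at_right (0::real). False"
  proof eventually_elim
    case (elim s)
    then have s: "0 < s" "s < d" "s < s0" "s < 1" by auto
    have "exp ((1 - s) * ln (I + s / (1 - s) * J) + s * ln m) = (I + s / (1 - s) * J) powr (1 - s) * m powr s"
      using elim(1) m by (simp add: powr_def exp_add)
    then have "0 \<le> F s" using bound[OF s(1,3,4) elim(1)] by (simp add: F_def)
    moreover have "F 0 = 0" using I by (simp add: F_def)
    ultimately show False using d(2)[OF s(1,2)] by simp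
  qed
  then show False by simp
qed

text \<open>The core of the argument. With \<open>t = 1 - s\<close>, the Prekopa-Leindler inequality for \<open>\<nu>\<close> is applied to
\<open>exp (g / t) * k\<close>, to \<open>k\<close>, and to \<open>exp (g + s * p\<^sup>2 / a) * k\<close>, where \<open>p\<close> exceeds the norm of the gradient slightly. The
Gaussian factor in \<open>k\<close> gains \<open>exp (- \<alpha> * t / (2 * s) * r\<^sup>2)\<close>, where \<open>r\<close> is the distance between \<open>x\<close> and
\<open>t *\<^sub>R x + s *\<^sub>R y\<close>, and this pays for replacing \<open>g x\<close> by \<open>g (t *\<^sub>R x + s *\<^sub>R y)\<close>. The resulting inequality is an equality at
\<open>s = 0\<close>, and its first-order term is the logarithmic Sobolev inequality.\<close>

lemma local_log_sobolev_exp: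
  fixes \<nu> :: "(real ^ 'n) measure" and g :: "real ^ 'n \<Rightarrow> real" and G :: "real ^ 'n \<Rightarrow> real ^ 'n"
  assumes \<nu>: "log_concave_measure \<nu>" and \<alpha>: "0 < \<alpha>" and R: "0 < R"
    and g: "\<And>x. GDERIV g x :> G x" and G: "continuous_on UNIV G"
  defines "k \<equiv> \<lambda>x. tent R x * exp (- (\<alpha> / 2) * (norm x)\<^sup>2)"
  defines "m \<equiv> \<integral>x. k x \<partial>\<nu>" and "I \<equiv> \<integral>x. exp (g x) * k x \<partial>\<nu>"
  assumes m: "0 < m"
  shows "(\<integral>x. g x * exp (g x) * k x \<partial>\<nu>) - I * ln (I / m)
     \<le> (\<integral>x. (norm (G x))\<^sup>2 * exp (g x) * k x \<partial>\<nu>) / (2 * \<alpha>)"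
proof -
  have sets: "sets \<nu> = sets borel" using \<nu> by (simp add: log_concave_measure_def)
  note fin = log_concave_measure_finite_on_bounded[OF \<nu>]
  have contg: "continuous_on UNIV g"
  proof (intro continuous_at_imp_continuous_on ballI)
    fix x show "isCont g x" using g[of x] unfolding gderiv_def by (rule has_derivative_continuous)
  qed
  have contk: "continuous_on UNIV k" unfolding k_def by (intro continuous_intros continuous_on_tent)
  have k0: "0 \<le> k x" for x by (simp add: k_def tent_nonneg)
  have ksupp: "k x = 0" if "x \<notin> cball 0 R" for x using that R by (simp add: k_def tent_eq_0)
  have int: "integrable \<nu> (\<lambda>x. q x * k x)" if "continuous_on UNIV q" for q
  proof (rule integrable_bounded_support[OF sets fin[of R]])
    show "continuous_on UNIV (\<lambda>x. q x * k x)" using that contk by (intro continuous_intros)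
  qed (simp add: ksupp)
  define J where "J = (\<integral>x. g x * exp (g x) * k x \<partial>\<nu>)"
  have bounded: "\<exists>B\<ge>0. \<forall>x\<in>cball 0 R. \<bar>q x\<bar> \<le> B" if "continuous_on UNIV q" for q :: "real ^ 'n \<Rightarrow> real"
  proof -
    have "compact (q ` cball 0 R)"
      using that by (intro compact_continuous_image) (auto intro: continuous_on_subset)
    then obtain B where "\<And>x. x \<in> cball 0 R \<Longrightarrow> norm (q x) \<le> B"
      by (metis bounded_iff compact_imp_bounded imageI)
    then have "\<forall>x\<in>cball 0 R. \<bar>q x\<bar> \<le> \<bar>B\<bar>" by fastforce
    then show ?thesis by (intro exI[of _ "\<bar>B\<bar>"]) simp
  qed
  have I: "0 < I"
  proof -
    obtain B where B: "\<forall>x\<in>cball 0 R. \<bar>g x\<bar> \<le> B" using bounded[OF contg] by blast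
    have "exp (- B) * m = (\<integral>x. exp (- B) * k x \<partial>\<nu>)" by (simp add: m_def)
    also have "\<dots> \<le> I" unfolding I_def
    proof (rule integral_mono)
      show "integrable \<nu> (\<lambda>x. exp (- B) * k x)" "integrable \<nu> (\<lambda>x. exp (g x) * k x)"
        using contg by (intro int continuous_intros)+
      show "exp (- B) * k x \<le> exp (g x) * k x" for x
      proof (cases "x \<in> cball 0 R")
        case True
        then have "\<bar>g x\<bar> \<le> B" using B by blast
        then have "- B \<le> g x" by linarith
        then show ?thesis using k0 by (intro mult_right_mono) auto
      qed (simp add: ksupp)
    qed
    finally show ?thesis using m by (smt (verit) exp_gt_zero mult_pos_pos)
  qed
  have main: "J - I * ln (I / m) \<le> (\<integral>x. (norm (G x) + \<epsilon>)\<^sup>2 * exp (g x) * k x \<partial>\<nu>) / (2 * \<alpha>)"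
    if \<epsilon>: "0 < \<epsilon>" for \<epsilon>
  proof -
    define p where "p x = norm (G x) + \<epsilon>" for x
    have contp: "continuous_on UNIV p" unfolding p_def by (intro continuous_intros G)
    define P where "P = (\<integral>x. (p x)\<^sup>2 * exp (g x) * k x \<partial>\<nu>)"
    obtain M where M: "0 \<le> M" "\<forall>x\<in>cball 0 R. \<bar>(p x)\<^sup>2\<bar> \<le> M"
      using bounded[of "\<lambda>x. (p x)\<^sup>2"] contp by (auto intro!: continuous_intros)
    have "\<exists>L\<ge>0. \<forall>x\<in>cball 0 R. \<forall>z\<in>cball 0 R.
       g x \<le> g z + (norm (G z) + \<epsilon>) * norm (x - z) + L * (norm (x - z))\<^sup>2"
      by (rule first_order_upper_bound) (use g \<epsilon> G in \<open>auto intro: continuous_on_subset\<close>)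
    then obtain L where L: "0 \<le> L" "\<And>x z. x \<in> cball 0 R \<Longrightarrow> z \<in> cball 0 R \<Longrightarrow>
       g x \<le> g z + p z * norm (x - z) + L * (norm (x - z))\<^sup>2"
      unfolding p_def by blast
    \<comment> \<open>For smaller \<open>s\<close> the coefficient \<open>a\<close> below is at least \<open>\<alpha>\<close> and, on the ball, the exponent \<open>s * (p x)\<^sup>2 / a\<close> is at most \<open>1\<close>.\<close>
    define s0 where "s0 = min (1 / 2) (min (\<alpha> / (2 * \<alpha> + 4 * L)) (\<alpha> / (M + 1)))"
    have s0: "0 < s0" using \<alpha> L M by (simp add: s0_def)
    have "J - I * ln (I / m) \<le> P / (2 * \<alpha>)"
    proof (rule entropy_bound_of_power_bounds[OF I m _ s0, where L = "4 * L" and C = "(M / \<alpha>)\<^sup>2 * I"])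
      show "0 < 2 * \<alpha>" using \<alpha> by simp
      fix s assume s: "0 < s" "s < s0" "s < 1" and pos: "0 < I + s / (1 - s) * J"
      define t where "t = 1 - s"
      have t: "0 < t" "t + s = 1" using s by (auto simp: t_def)
      \<comment> \<open>What remains of the Gaussian gain after paying for \<open>L * r\<^sup>2\<close> is \<open>a / (4 * s) * r\<^sup>2\<close>.\<close>
      define a where "a = 2 * \<alpha> * t - 4 * L * s"
      have a: "\<alpha> \<le> a"
      proof -
        have "s \<le> \<alpha> / (2 * \<alpha> + 4 * L)" using s(2) by (simp add: s0_def)
        then have "s * (2 * \<alpha> + 4 * L) \<le> \<alpha>" using \<alpha> L(1) by (simp add: pos_le_divide_eq)
        then show ?thesis by (simp add: a_def t_def algebra_simps)
      qed
      have sM: "s * M \<le> \<alpha>"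
      proof -
        have "s \<le> \<alpha> / (M + 1)" using s(2) by (simp add: s0_def)
        then have "s * (M + 1) \<le> \<alpha>" using M by (simp add: pos_le_divide_eq)
        then show ?thesis using s(1) by (simp add: algebra_simps)
      qed
      define W where "W z = exp (g z + s * (p z)\<^sup>2 / a) * k z" for z
      have contW: "continuous_on UNIV W" unfolding W_def using contg contp contk a \<alpha>
        by (intro continuous_intros) auto
      have "(\<integral>x. exp (g x / t) * k x \<partial>\<nu>) powr t * (\<integral>x. k x \<partial>\<nu>) powr s \<le> (\<integral>x. W x \<partial>\<nu>)"
      proof (rule prekopa_leindler_log_concave_measure[OF \<nu> t(1) s(1) t(2), where R = R])
        show "continuous_on UNIV (\<lambda>x. exp (g x / t) * k x)"
          using contg contk t by (intro continuous_intros) auto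
        show "W x = 0" if "x \<notin> cball 0 R" for x using ksupp[OF that] by (simp add: W_def)
        fix x y :: "real ^ 'n"
        let ?z = "t *\<^sub>R x + s *\<^sub>R y"
        show "(exp (g x / t) * k x) powr t * k y powr s \<le> W ?z"
        proof (cases "x \<in> cball 0 R \<and> y \<in> cball 0 R")
          case False
          then show ?thesis using ksupp k0 by (auto simp: W_def)
        next
          case True
          have z: "?z \<in> cball 0 R"
            using convexD[OF convex_cball, of x 0 R y t s] True t s by auto
          have tents: "tent R x powr t * tent R y powr s \<le> tent R ?z"
            using log_concave_tent[OF R] t s unfolding log_concave_def by (meson less_imp_le)
          let ?r = "norm (x - ?z)"
          have "x - ?z = s *\<^sub>R (x - y)"
            using t(2) by (simp add: t_def algebra_simps)
          then have r: "?r = s * norm (x - y)" using s by simp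
          have sq: "t * (norm x)\<^sup>2 + s * (norm y)\<^sup>2 = (norm ?z)\<^sup>2 + (t / s) * ?r\<^sup>2"
            unfolding r weighted_square_norm_identity[OF t(2), of x y] using s
            by (simp add: power_mult_distrib power2_eq_square)
          define q where "q = t * (\<alpha> / 2 * (norm x)\<^sup>2) + s * (\<alpha> / 2 * (norm y)\<^sup>2)"
          have "q = (\<alpha> / 2) * (t * (norm x)\<^sup>2 + s * (norm y)\<^sup>2)" by (simp add: q_def algebra_simps)
          also have "\<dots> = \<alpha> / 2 * (norm ?z)\<^sup>2 + (\<alpha> / 2) * (t / s) * ?r\<^sup>2"
            unfolding sq by (simp only: distrib_left mult.assoc)
          also have "(\<alpha> / 2) * (t / s) = a / (4 * s) + L"
            using s by (simp add: a_def field_simps)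
          finally have q: "q = \<alpha> / 2 * (norm ?z)\<^sup>2 + ((a / (4 * s)) * ?r\<^sup>2 + L * ?r\<^sup>2)"
            by (simp only: distrib_right)
          have "g x \<le> g ?z + p ?z * ?r + L * ?r\<^sup>2" using L(2) True z by blast
          moreover have "p ?z * ?r - (a / (4 * s)) * ?r\<^sup>2 \<le> (p ?z)\<^sup>2 / (4 * (a / (4 * s)))"
            using a \<alpha> s by (intro quadratic_upper_bound) auto
          moreover have "(p ?z)\<^sup>2 / (4 * (a / (4 * s))) = s * (p ?z)\<^sup>2 / a" by simp
          ultimately have expo: "g x - q \<le> (g ?z + s * (p ?z)\<^sup>2 / a) - \<alpha> / 2 * (norm ?z)\<^sup>2"
            unfolding q by linarith
          have "exp (g x / t) * k x = tent R x * exp (g x / t + - (\<alpha> / 2) * (norm x)\<^sup>2)"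
            unfolding k_def exp_add by (simp only: ac_simps)
          moreover have "k y = tent R y * exp (- (\<alpha> / 2) * (norm y)\<^sup>2)" by (simp only: k_def)
          moreover have "(g x / t + - (\<alpha> / 2) * (norm x)\<^sup>2) * t + (- (\<alpha> / 2) * (norm y)\<^sup>2) * s = g x - q"
            using t by (simp add: q_def algebra_simps)
          ultimately have "(exp (g x / t) * k x) powr t * k y powr s
             = (tent R x powr t * tent R y powr s) * exp (g x - q)"
            using tent_nonneg[of R x] tent_nonneg[of R y]
            by (simp only: powr_mult exp_powr_real exp_add[symmetric] mult.assoc mult.left_commute[of "exp _"])
          also have "\<dots> \<le> tent R ?z * exp ((g ?z + s * (p ?z)\<^sup>2 / a) + - (\<alpha> / 2) * (norm ?z)\<^sup>2)"
            using tents expo tent_nonneg by (intro mult_mono) auto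
          also have "\<dots> = W ?z"
            unfolding W_def k_def exp_add by (simp only: ac_simps)
          finally show ?thesis .
        qed
      qed (use k0 contk contW ksupp in \<open>auto simp: W_def\<close>)
      then have PL: "(\<integral>x. exp (g x / t) * k x \<partial>\<nu>) powr t * m powr s \<le> (\<integral>x. W x \<partial>\<nu>)"
        by (simp add: m_def)
      \<comment> \<open>Since \<open>1 / t = 1 + s / t\<close>, convexity of the exponential gives a lower bound that is linear in \<open>J\<close>.\<close>
      have lower: "I + s / t * J \<le> (\<integral>x. exp (g x / t) * k x \<partial>\<nu>)"
      proof -
        have "I + s / t * J = (\<integral>x. exp (g x) * k x + s / t * (g x * exp (g x) * k x) \<partial>\<nu>)"
          unfolding I_def J_def using contg
          by (subst Bochner_Integration.integral_add) (auto intro!: int continuous_intros integrable_mult_right)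
        also have "\<dots> \<le> (\<integral>x. exp (g x / t) * k x \<partial>\<nu>)"
        proof (rule integral_mono)
          show "integrable \<nu> (\<lambda>x. exp (g x) * k x + s / t * (g x * exp (g x) * k x))"
            "integrable \<nu> (\<lambda>x. exp (g x / t) * k x)"
            using contg t by (auto intro!: int continuous_intros integrable_mult_right Bochner_Integration.integrable_add)
          fix x
          have "g x / t = g x + s / t * g x" using t by (simp add: t_def field_simps)
          then have "exp (g x / t) = exp (g x) * exp (s / t * g x)" by (simp add: exp_add)
          moreover have "exp (g x) * (1 + s / t * g x) \<le> exp (g x) * exp (s / t * g x)"
            by (intro mult_left_mono exp_ge_add_one_self) auto
          ultimately have "exp (g x) * (1 + s / t * g x) * k x \<le> exp (g x / t) * k x"
            using k0 by (intro mult_right_mono) auto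
          then show "exp (g x) * k x + s / t * (g x * exp (g x) * k x) \<le> exp (g x / t) * k x"
            by (simp add: algebra_simps)
        qed
        finally show ?thesis .
      qed
      \<comment> \<open>The exponent added to \<open>g\<close> in \<open>W\<close> is at most \<open>1\<close> on the ball, so a second-order expansion suffices.\<close>
      have upper: "(\<integral>x. W x \<partial>\<nu>) \<le> I + s / a * P + s\<^sup>2 * ((M / \<alpha>)\<^sup>2 * I)"
      proof -
        have "(\<integral>x. W x \<partial>\<nu>) \<le> (\<integral>x. exp (g x) * k x + s / a * ((p x)\<^sup>2 * exp (g x) * k x)
             + s\<^sup>2 * ((M / \<alpha>)\<^sup>2 * (exp (g x) * k x)) \<partial>\<nu>)"
        proof (rule integral_mono)
          show "integrable \<nu> W" unfolding W_def using contg contp a \<alpha> by (intro int continuous_intros) auto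
          show "integrable \<nu> (\<lambda>x. exp (g x) * k x + s / a * ((p x)\<^sup>2 * exp (g x) * k x)
             + s\<^sup>2 * ((M / \<alpha>)\<^sup>2 * (exp (g x) * k x)))"
            using contg contp by (auto intro!: int continuous_intros integrable_mult_right Bochner_Integration.integrable_add)
          fix x
          show "W x \<le> exp (g x) * k x + s / a * ((p x)\<^sup>2 * exp (g x) * k x)
             + s\<^sup>2 * ((M / \<alpha>)\<^sup>2 * (exp (g x) * k x))"
          proof (cases "x \<in> cball 0 R")
            case True
            let ?e = "s * (p x)\<^sup>2 / a"
            have "?e \<le> s * M / \<alpha>"
              using True M a \<alpha> s by (intro frac_le mult_left_mono mult_nonneg_nonneg) auto
            moreover have "s * M / \<alpha> \<le> 1" using sM \<alpha> by simp
            moreover have e0: "0 \<le> ?e" using s a \<alpha> by simp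
            ultimately have "exp ?e \<le> 1 + ?e + ?e\<^sup>2" "?e\<^sup>2 \<le> (s * M / \<alpha>)\<^sup>2"
              by (auto intro!: exp_bound power_mono)
            then have "exp ?e \<le> 1 + ?e + s\<^sup>2 * (M / \<alpha>)\<^sup>2"
              by (simp add: power_mult_distrib power_divide)
            then have "exp (g x) * k x * exp ?e \<le> exp (g x) * k x * (1 + ?e + s\<^sup>2 * (M / \<alpha>)\<^sup>2)"
              using k0 by (intro mult_left_mono) auto
            then show ?thesis by (simp add: W_def exp_add algebra_simps)
          qed (simp add: W_def ksupp)
        qed
        also have "\<dots> = I + s / a * P + s\<^sup>2 * ((M / \<alpha>)\<^sup>2 * I)"
        proof -
          have i: "integrable \<nu> (\<lambda>x. exp (g x) * k x)" "integrable \<nu> (\<lambda>x. (p x)\<^sup>2 * exp (g x) * k x)"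
            using contg contp by (auto intro!: int continuous_intros)
          show ?thesis unfolding I_def P_def using i by simp
        qed
        finally show ?thesis .
      qed
      have "(I + s / t * J) powr t * m powr s \<le> (\<integral>x. exp (g x / t) * k x \<partial>\<nu>) powr t * m powr s"
        using lower pos t by (intro mult_right_mono powr_mono2) (auto simp: t_def)
      also note PL
      also note upper
      finally show "(I + s / (1 - s) * J) powr (1 - s) * m powr s
          \<le> I + s / (2 * \<alpha> * (1 - s) - 4 * L * s) * P + s\<^sup>2 * ((M / \<alpha>)\<^sup>2 * I)"
        by (simp add: t_def a_def)
    qed
    then show ?thesis by (simp add: P_def p_def)
  qed
  define P where "P = (\<integral>x. (norm (G x))\<^sup>2 * exp (g x) * k x \<partial>\<nu>)"
  define Q where "Q = (\<integral>x. norm (G x) * exp (g x) * k x \<partial>\<nu>)"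
  have "(\<integral>x. (norm (G x) + \<epsilon>)\<^sup>2 * exp (g x) * k x \<partial>\<nu>) = P + 2 * \<epsilon> * Q + \<epsilon>\<^sup>2 * I" for \<epsilon>
  proof -
    have i: "integrable \<nu> (\<lambda>x. (norm (G x))\<^sup>2 * exp (g x) * k x)"
      "integrable \<nu> (\<lambda>x. norm (G x) * exp (g x) * k x)" "integrable \<nu> (\<lambda>x. exp (g x) * k x)"
      using contg G by (auto intro!: int continuous_intros)
    have "(norm (G x) + \<epsilon>)\<^sup>2 * exp (g x) * k x = (norm (G x))\<^sup>2 * exp (g x) * k x
       + 2 * \<epsilon> * (norm (G x) * exp (g x) * k x) + \<epsilon>\<^sup>2 * (exp (g x) * k x)" for x
      by (simp add: power2_sum algebra_simps)
    then show ?thesis unfolding P_def Q_def I_def using i by simp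
  qed
  then have le: "J - I * ln (I / m) \<le> (P + 2 * \<epsilon> * Q + \<epsilon>\<^sup>2 * I) / (2 * \<alpha>)" if "0 < \<epsilon>" for \<epsilon>
    using main[OF that] by simp
  have "((\<lambda>\<epsilon>. (P + 2 * \<epsilon> * Q + \<epsilon>\<^sup>2 * I) / (2 * \<alpha>)) \<longlongrightarrow> (P + 2 * 0 * Q + 0\<^sup>2 * I) / (2 * \<alpha>)) (at_right 0)"
    using \<alpha> by (intro tendsto_intros) auto
  then have "J - I * ln (I / m) \<le> (P + 2 * 0 * Q + 0\<^sup>2 * I) / (2 * \<alpha>)"
    by (rule tendsto_lowerbound) (auto intro!: eventually_mono[OF eventually_at_right_less] le)
  then show ?thesis by (simp add: J_def P_def)
qed

lemma mult_ln_ge_minus_one: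
  fixes y :: real
  assumes "0 \<le> y" shows "- 1 \<le> y * ln y"
proof (cases "y = 0")
  case False
  then have y: "0 < y" using assms by simp
  then have "ln (1 / y) \<le> 1 / y - 1" by (intro ln_le_minus_one) simp
  then have "y * (1 - 1 / y) \<le> y * ln y" using y by (intro mult_left_mono) (auto simp: ln_div)
  then show ?thesis using y by (simp add: algebra_simps)
qed simp

lemma mult_ln_le_square:
  fixes y :: real
  assumes "0 \<le> y" shows "y * ln y \<le> y\<^sup>2"
proof (cases "y = 0")
  case False
  then have "ln y \<le> y - 1" using assms by (intro ln_le_minus_one) simp
  then have "y * ln y \<le> y * y" using assms by (intro mult_left_mono) auto
  then show ?thesis by (simp add: power2_eq_square)
qed simp

text \<open>Superadditivity of \<open>y * ln y\<close>, combined with an explicit lower bound for \<open>d * ln d\<close> that tends to zero with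
\<open>d\<close>.\<close>

lemma mult_ln_add_ge:
  fixes y d :: real
  assumes "0 \<le> y" "0 < d" shows "y * ln y - 2 * sqrt d \<le> (d + y) * ln (d + y)"
proof -
  have "y * ln y \<le> y * ln (d + y)"
    using assms by (cases "y = 0") (auto intro!: mult_left_mono)
  moreover have "d * ln d \<le> d * ln (d + y)" using assms by (auto intro!: mult_left_mono)
  moreover have "- (2 * sqrt d) \<le> d * ln d"
  proof -
    have "d * ln d = (2 * sqrt d) * (sqrt d * ln (sqrt d))"
      using assms by (simp add: ln_sqrt)
    moreover have "(2 * sqrt d) * (- 1) \<le> (2 * sqrt d) * (sqrt d * ln (sqrt d))"
      using assms by (intro mult_left_mono mult_ln_ge_minus_one) auto
    ultimately show ?thesis by simp
  qed
  ultimately show ?thesis by (simp add: distrib_right)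
qed

text \<open>The exponential version is applied to \<open>ln (d + f\<^sup>2)\<close>, which is defined also where \<open>f\<close> vanishes; its energy is
at most four times that of \<open>f\<close>, independently of \<open>d\<close>. Then \<open>d\<close> tends to zero.\<close>

lemma local_log_sobolev:
  fixes \<rho> :: "(real ^ 'n) measure" and f :: "real ^ 'n \<Rightarrow> real" and G :: "real ^ 'n \<Rightarrow> real ^ 'n"
  assumes \<alpha>: "0 < \<alpha>" and slc: "super_log_concave_measure \<alpha> \<rho>" and R: "0 < R"
    and f: "\<And>x. GDERIV f x :> G x" and G: "continuous_on UNIV G"
  defines "m \<equiv> \<integral>x. tent R x \<partial>\<rho>" and "a \<equiv> \<integral>x. (f x)\<^sup>2 * tent R x \<partial>\<rho>"
  assumes m: "0 < m" and a: "0 < a"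
  shows "integrable \<rho> (\<lambda>x. (f x)\<^sup>2 * ln ((f x)\<^sup>2) * tent R x)"
    and "(\<integral>x. (f x)\<^sup>2 * ln ((f x)\<^sup>2) * tent R x \<partial>\<rho>) - a * ln (a / m)
       \<le> 2 / \<alpha> * (\<integral>x. (norm (G x))\<^sup>2 * tent R x \<partial>\<rho>)"
proof -
  define \<nu> where "\<nu> = density \<rho> (\<lambda>x. ennreal (exp (\<alpha> / 2 * (norm x)\<^sup>2)))"
  have sets[measurable_cong]: "sets \<rho> = sets borel" and \<nu>: "log_concave_measure \<nu>"
    using slc by (auto simp: super_log_concave_measure_def \<nu>_def)
  interpret finite_measure \<rho> by (rule finite_measure_super_log_concave[OF \<alpha> slc])
  have contf: "continuous_on UNIV f"
  proof (intro continuous_at_imp_continuous_on ballI)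
    fix x show "isCont f x" using f[of x] unfolding gderiv_def by (rule has_derivative_continuous)
  qed
  have meas: "q \<in> borel_measurable borel" if "continuous_on UNIV q" for q :: "real ^ 'n \<Rightarrow> real"
    using that by (rule borel_measurable_continuous_onI)
  have [measurable]: "f \<in> borel_measurable borel" by (rule meas[OF contf])
  have int: "integrable \<rho> (\<lambda>x. q x * tent R x)" if "continuous_on UNIV q" for q :: "real ^ 'n \<Rightarrow> real"
  proof (rule integrable_bounded_support[OF sets, where R = R])
    show "emeasure \<rho> (cball 0 R) < \<infinity>" using emeasure_finite by (simp add: less_top[symmetric])
    show "continuous_on UNIV (\<lambda>x. q x * tent R x)" using that by (intro continuous_intros continuous_on_tent)
  qed (use R in \<open>simp add: tent_eq_0\<close>)
  have change: "(\<integral>x. q x * (tent R x * exp (- (\<alpha> / 2) * (norm x)\<^sup>2)) \<partial>\<nu>) = (\<integral>x. q x * tent R x \<partial>\<rho>)"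
    if [measurable]: "q \<in> borel_measurable borel" for q
  proof -
    have "(\<integral>x. q x * (tent R x * exp (- (\<alpha> / 2) * (norm x)\<^sup>2)) \<partial>\<nu>)
      = (\<integral>x. exp (\<alpha> / 2 * (norm x)\<^sup>2) *\<^sub>R (q x * (tent R x * exp (- (\<alpha> / 2) * (norm x)\<^sup>2))) \<partial>\<rho>)"
      unfolding \<nu>_def by (rule integral_density) auto
    also have "\<dots> = (\<integral>x. q x * tent R x \<partial>\<rho>)"
    proof (rule Bochner_Integration.integral_cong[OF refl])
      fix x :: "real ^ 'n"
      have "exp (\<alpha> / 2 * (norm x)\<^sup>2) * exp (- (\<alpha> / 2) * (norm x)\<^sup>2) = 1"
        by (simp add: exp_add[symmetric])
      then show "exp (\<alpha> / 2 * (norm x)\<^sup>2) *\<^sub>R (q x * (tent R x * exp (- (\<alpha> / 2) * (norm x)\<^sup>2))) = q x * tent R x"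
        by (simp only: real_scaleR_def mult.left_commute[of "exp (\<alpha> / 2 * (norm x)\<^sup>2)"] mult_1_right)
    qed
    finally show ?thesis .
  qed
  show int_ent: "integrable \<rho> (\<lambda>x. (f x)\<^sup>2 * ln ((f x)\<^sup>2) * tent R x)"
  proof (rule Bochner_Integration.integrable_bound)
    show "integrable \<rho> (\<lambda>x. (1 + ((f x)\<^sup>2)\<^sup>2) * tent R x)"
      using contf by (intro int continuous_intros)
    have "\<bar>(f x)\<^sup>2 * ln ((f x)\<^sup>2)\<bar> * tent R x \<le> (1 + ((f x)\<^sup>2)\<^sup>2) * tent R x" for x
      using mult_ln_ge_minus_one[OF zero_le_power2, of "f x"] mult_ln_le_square[OF zero_le_power2, of "f x"]
        zero_le_power2[of "(f x)\<^sup>2"]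
      by (intro mult_right_mono tent_nonneg) linarith
    then show "AE x in \<rho>. norm ((f x)\<^sup>2 * ln ((f x)\<^sup>2) * tent R x) \<le> norm ((1 + ((f x)\<^sup>2)\<^sup>2) * tent R x)"
      by (auto simp: abs_mult tent_nonneg)
  qed measurable
  define E where "E = (\<integral>x. (f x)\<^sup>2 * ln ((f x)\<^sup>2) * tent R x \<partial>\<rho>)"
  define K where "K = (\<integral>x. (norm (G x))\<^sup>2 * tent R x \<partial>\<rho>)"
  have regularized: "E - 2 * sqrt d * m - (a + d * m) * ln ((a + d * m) / m) \<le> 2 / \<alpha> * K" if d: "0 < d" for d
  proof -
    have pos: "0 < d + (f x)\<^sup>2" for x using d by (simp add: add_pos_nonneg)
    define g where "g x = ln (d + (f x)\<^sup>2)" for x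
    define G' where "G' x = (2 * f x / (d + (f x)\<^sup>2)) *\<^sub>R G x" for x
    have eg: "exp (g x) = d + (f x)\<^sup>2" for x using pos[of x] by (simp add: g_def)
    have contg: "continuous_on UNIV g" unfolding g_def using contf pos
      by (intro continuous_intros) (auto simp: less_imp_neq[symmetric])
    have contG': "continuous_on UNIV G'" unfolding G'_def using contf G pos
      by (intro continuous_intros) (auto simp: less_imp_neq[symmetric])
    note [measurable] = meas[OF contg]
    have [measurable]: "(\<lambda>x. norm (G x)) \<in> borel_measurable borel" "(\<lambda>x. norm (G' x)) \<in> borel_measurable borel"
      using G contG' by (intro meas continuous_intros; simp)+
    have Dg: "GDERIV g x :> G' x" for x
      unfolding g_def G'_def
    proof (rule GDERIV_DERIV_compose[OF f, where g = "\<lambda>y. ln (d + y\<^sup>2)"])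
      show "((\<lambda>y. ln (d + y\<^sup>2)) has_real_derivative 2 * f x / (d + (f x)\<^sup>2)) (at (f x))"
        using pos[of x] by (auto intro!: derivative_eq_intros)
    qed
    let ?k = "\<lambda>x. tent R x * exp (- (\<alpha> / 2) * (norm x)\<^sup>2)"
    have m': "(\<integral>x. ?k x \<partial>\<nu>) = m" using change[of "\<lambda>_. 1"] by (simp add: m_def)
    have I': "(\<integral>x. exp (g x) * ?k x \<partial>\<nu>) = a + d * m"
    proof -
      have "(\<integral>x. exp (g x) * ?k x \<partial>\<nu>) = (\<integral>x. exp (g x) * tent R x \<partial>\<rho>)" by (rule change) measurable
      also have "\<dots> = (\<integral>x. (f x)\<^sup>2 * tent R x + d * tent R x \<partial>\<rho>)" by (simp add: eg algebra_simps)
      also have "\<dots> = a + d * m"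
        unfolding a_def m_def using int[of "\<lambda>x. (f x)\<^sup>2"] int[of "\<lambda>_. 1"] contf
        by (simp add: continuous_intros)
      finally show ?thesis .
    qed
    have exp_bound: "(\<integral>x. g x * exp (g x) * ?k x \<partial>\<nu>) - (\<integral>x. exp (g x) * ?k x \<partial>\<nu>) * ln ((\<integral>x. exp (g x) * ?k x \<partial>\<nu>) / (\<integral>x. ?k x \<partial>\<nu>))
       \<le> (\<integral>x. (norm (G' x))\<^sup>2 * exp (g x) * ?k x \<partial>\<nu>) / (2 * \<alpha>)"
      by (rule local_log_sobolev_exp[OF \<nu> \<alpha> R Dg contG']) (use m in \<open>simp only: m'\<close>)
    have J': "(\<integral>x. g x * exp (g x) * ?k x \<partial>\<nu>) = (\<integral>x. g x * exp (g x) * tent R x \<partial>\<rho>)"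
      by (rule change) measurable
    have P': "(\<integral>x. (norm (G' x))\<^sup>2 * exp (g x) * ?k x \<partial>\<nu>) = (\<integral>x. (norm (G' x))\<^sup>2 * exp (g x) * tent R x \<partial>\<rho>)"
      by (rule change) measurable
    have "E - 2 * sqrt d * m \<le> (\<integral>x. g x * exp (g x) * tent R x \<partial>\<rho>)"
    proof -
      have i: "integrable \<rho> (\<lambda>x. tent R x)" using int[of "\<lambda>_. 1"] by simp
      have "E - 2 * sqrt d * m = (\<integral>x. (f x)\<^sup>2 * ln ((f x)\<^sup>2) * tent R x - 2 * sqrt d * tent R x \<partial>\<rho>)"
        unfolding E_def m_def using int_ent i by simp
      also have "\<dots> \<le> (\<integral>x. g x * exp (g x) * tent R x \<partial>\<rho>)"
      proof (rule integral_mono)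
        show "integrable \<rho> (\<lambda>x. (f x)\<^sup>2 * ln ((f x)\<^sup>2) * tent R x - 2 * sqrt d * tent R x)"
          using int_ent i by simp
        show "integrable \<rho> (\<lambda>x. g x * exp (g x) * tent R x)" using contg by (intro int continuous_intros)
        fix x
        have "(f x)\<^sup>2 * ln ((f x)\<^sup>2) - 2 * sqrt d \<le> g x * exp (g x)"
          unfolding eg using mult_ln_add_ge[of "(f x)\<^sup>2" d] d by (simp add: g_def mult.commute)
        then have "((f x)\<^sup>2 * ln ((f x)\<^sup>2) - 2 * sqrt d) * tent R x \<le> g x * exp (g x) * tent R x"
          by (rule mult_right_mono) (rule tent_nonneg)
        then show "(f x)\<^sup>2 * ln ((f x)\<^sup>2) * tent R x - 2 * sqrt d * tent R x \<le> g x * exp (g x) * tent R x"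
          by (simp only: left_diff_distrib)
      qed
      finally show ?thesis .
    qed
    moreover have "(\<integral>x. (norm (G' x))\<^sup>2 * exp (g x) * tent R x \<partial>\<rho>) / (2 * \<alpha>) \<le> 2 / \<alpha> * K"
    proof -
      have "(\<integral>x. (norm (G' x))\<^sup>2 * exp (g x) * tent R x \<partial>\<rho>) \<le> (\<integral>x. 4 * ((norm (G x))\<^sup>2 * tent R x) \<partial>\<rho>)"
      proof (rule integral_mono)
        show "integrable \<rho> (\<lambda>x. (norm (G' x))\<^sup>2 * exp (g x) * tent R x)"
          "integrable \<rho> (\<lambda>x. 4 * ((norm (G x))\<^sup>2 * tent R x))"
          using contg contG' G by (auto intro!: int continuous_intros integrable_mult_right)
        fix x
        have "(norm (G' x))\<^sup>2 * exp (g x) = ((f x)\<^sup>2 / (d + (f x)\<^sup>2)) * (4 * (norm (G x))\<^sup>2)"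
          unfolding eg G'_def using pos[of x]
          by (simp add: power_mult_distrib power_divide power2_eq_square)
        also have "\<dots> \<le> 1 * (4 * (norm (G x))\<^sup>2)"
          using pos[of x] d by (intro mult_right_mono) (auto simp: divide_le_eq)
        finally have "(norm (G' x))\<^sup>2 * exp (g x) * tent R x \<le> 1 * (4 * (norm (G x))\<^sup>2) * tent R x"
          by (rule mult_right_mono) (rule tent_nonneg)
        then show "(norm (G' x))\<^sup>2 * exp (g x) * tent R x \<le> 4 * ((norm (G x))\<^sup>2 * tent R x)"
          by (simp only: mult.assoc mult_1_left)
      qed
      also have "\<dots> = 4 * K" by (simp add: K_def)
      finally show ?thesis using \<alpha> by (simp add: divide_le_eq field_simps)
    qed
    ultimately show ?thesis using exp_bound[unfolded m' I' J' P'] by linarith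
  qed
  have "((\<lambda>d. E - 2 * sqrt d * m - (a + d * m) * ln ((a + d * m) / m)) \<longlongrightarrow>
     E - 2 * sqrt 0 * m - (a + 0 * m) * ln ((a + 0 * m) / m)) (at_right 0)"
    using a m by (intro tendsto_intros) auto
  then have "E - 2 * sqrt 0 * m - (a + 0 * m) * ln ((a + 0 * m) / m) \<le> 2 / \<alpha> * K"
    by (rule tendsto_upperbound[OF _ eventually_mono[OF eventually_at_right_less regularized]]) simp_all
  then show "(\<integral>x. (f x)\<^sup>2 * ln ((f x)\<^sup>2) * tent R x \<partial>\<rho>) - a * ln (a / m)
       \<le> 2 / \<alpha> * (\<integral>x. (norm (G x))\<^sup>2 * tent R x \<partial>\<rho>)"
    by (simp add: E_def K_def)
qed

section \<open>Gradients of smooth functions and removal of the cutoff\<close>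

lemma gradient_eqI:
  assumes "GDERIV f x :> D" shows "gradient f x = D"
  unfolding gradient_def
proof (rule the_equality)
  show "GDERIV f x :> D" by fact
  fix D' assume "GDERIV f x :> D'"
  then have "(\<lambda>h. h \<bullet> D') = (\<lambda>h. h \<bullet> D)"
    using assms unfolding gderiv_def by (rule has_derivative_unique)
  then show "D' = D" by (metis vector_eq_ldot)
qed

lemma smooth_gradient:
  fixes f :: "'a::euclidean_space \<Rightarrow> real"
  assumes "smooth f"
  shows "GDERIV f x :> gradient f x" "continuous_on UNIV (gradient f)"
proof -
  have "continuously_differentiable (Suc 0) f" using assms by (simp add: smooth_def)
  then have diff: "f differentiable (at x)"
    and cont: "continuous_on UNIV (\<lambda>x. frechet_derivative f (at x) v)" for x v
    by auto
  define D where "D x = (\<Sum>b\<in>Basis. frechet_derivative f (at x) b *\<^sub>R b)" for x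
  have D: "GDERIV f x :> D x" for x
  proof -
    have der: "(f has_derivative frechet_derivative f (at x)) (at x)"
      using diff frechet_derivative_works by blast
    then have lin: "linear (frechet_derivative f (at x))" by (rule has_derivative_linear)
    have "frechet_derivative f (at x) h = h \<bullet> D x" for h
    proof -
      have "frechet_derivative f (at x) h = frechet_derivative f (at x) (\<Sum>b\<in>Basis. (h \<bullet> b) *\<^sub>R b)"
        by (simp add: euclidean_representation)
      also have "\<dots> = (\<Sum>b\<in>Basis. (h \<bullet> b) * frechet_derivative f (at x) b)"
        using lin by (simp add: linear_sum linear_scale)
      also have "\<dots> = h \<bullet> D x" by (simp add: D_def inner_sum_right mult.commute)
      finally show ?thesis .
    qed
    then have "frechet_derivative f (at x) = (\<lambda>h. h \<bullet> D x)" by auto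
    then show ?thesis using der by (simp add: gderiv_def)
  qed
  then have eq: "gradient f = D" by (auto intro: gradient_eqI)
  show "GDERIV f x :> gradient f x" unfolding eq by (rule D)
  show "continuous_on UNIV (gradient f)"
    unfolding eq D_def by (intro continuous_intros cont)
qed

lemma tent_tendsto_1: "(\<lambda>n. tent (real (Suc n)) x) \<longlonglongrightarrow> 1"
proof -
  have "(\<lambda>n. max 0 (1 - norm x * inverse (real (Suc n)))) \<longlonglongrightarrow> max 0 (1 - norm x * 0)"
    by (intro tendsto_intros LIMSEQ_inverse_real_of_nat)
  then show ?thesis by (simp add: tent_def divide_inverse)
qed

lemma integral_tent_tendsto:
  fixes \<mu> :: "'a::euclidean_space measure" and q :: "'a \<Rightarrow> real"
  assumes [measurable_cong]: "sets \<mu> = sets borel" and q: "integrable \<mu> q"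
  shows "(\<lambda>n. \<integral>x. q x * tent (real (Suc n)) x \<partial>\<mu>) \<longlonglongrightarrow> (\<integral>x. q x \<partial>\<mu>)"
proof (rule integral_dominated_convergence)
  have [measurable]: "q \<in> borel_measurable \<mu>" using q by auto
  show "integrable \<mu> (\<lambda>x. \<bar>q x\<bar>)" using q by simp
  show "(\<lambda>x. q x * tent (real (Suc n)) x) \<in> borel_measurable \<mu>" for n by measurable
  have "(\<lambda>n. q x * tent (real (Suc n)) x) \<longlonglongrightarrow> q x * 1" for x
    by (intro tendsto_mult tendsto_const tent_tendsto_1)
  then show "AE x in \<mu>. (\<lambda>n. q x * tent (real (Suc n)) x) \<longlonglongrightarrow> q x" by simp
  have "\<bar>q x\<bar> * tent (real (Suc n)) x \<le> \<bar>q x\<bar> * 1" for x n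
    by (intro mult_left_mono tent_le_1) auto
  then show "AE x in \<mu>. norm (q x * tent (real (Suc n)) x) \<le> \<bar>q x\<bar>" for n
    by (simp add: abs_mult tent_nonneg)
qed (use q in auto)

theorem theorem4:
  fixes \<rho> :: "(real ^ 'n) measure" and \<alpha> :: real and f :: "real ^ 'n \<Rightarrow> real"
  assumes "0 < \<alpha>"
    and "super_log_concave_measure \<alpha> \<rho>"
    and "1 \<le> emeasure \<rho> (space \<rho>)"
    and "smooth f"
    and "extended_integral \<rho> (\<lambda>x. (f x)\<^sup>2) = 1"
  shows "extended_integral \<rho> (\<lambda>x. (f x)\<^sup>2 * ln ((f x)\<^sup>2))
           \<le> ereal (2 / \<alpha>) * extended_integral \<rho> (\<lambda>x. (norm (gradient f x))\<^sup>2)"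
proof -
  note \<alpha> = assms(1) and slc = assms(2)
  define G where "G = gradient f"
  have Df: "GDERIV f x :> G x" and contG: "continuous_on UNIV G" for x
    using smooth_gradient[OF assms(4)] by (auto simp: G_def)
  have sets[measurable_cong]: "sets \<rho> = sets borel"
    using slc by (simp add: super_log_concave_measure_def)
  interpret finite_measure \<rho> by (rule finite_measure_super_log_concave[OF \<alpha> slc])
  have contf: "continuous_on UNIV f"
  proof (intro continuous_at_imp_continuous_on ballI)
    fix x show "isCont f x" using Df[of x] unfolding gderiv_def by (rule has_derivative_continuous)
  qed
  have [measurable]: "f \<in> borel_measurable borel" "G \<in> borel_measurable borel"
    using contf contG by (auto intro: borel_measurable_continuous_onI)
  define M where "M = measure \<rho> (space \<rho>)"
  have M: "1 \<le> M" using assms(3) by (simp add: M_def emeasure_eq_measure)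
  have "enn2ereal (\<integral>\<^sup>+x. ennreal ((f x)\<^sup>2) \<partial>\<rho>) = enn2ereal 1"
    using assms(5) by (simp add: extended_integral_def ennreal_neg zero_ennreal.rep_eq one_ennreal.rep_eq)
  then have f1: "(\<integral>\<^sup>+x. ennreal ((f x)\<^sup>2) \<partial>\<rho>) = ennreal 1" by (simp only: enn2ereal_inject ennreal_1)
  have intf: "integrable \<rho> (\<lambda>x. (f x)\<^sup>2)" "(\<integral>x. (f x)\<^sup>2 \<partial>\<rho>) = 1"
    using nn_integral_eq_integrable[of "\<lambda>x. (f x)\<^sup>2" \<rho> 1] f1 by auto
  have energy: "extended_integral \<rho> (\<lambda>x. (norm (gradient f x))\<^sup>2) = enn2ereal (\<integral>\<^sup>+x. ennreal ((norm (G x))\<^sup>2) \<partial>\<rho>)"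
    by (simp add: extended_integral_def ennreal_neg zero_ennreal.rep_eq G_def)
  show ?thesis
  proof (cases "(\<integral>\<^sup>+x. ennreal ((norm (G x))\<^sup>2) \<partial>\<rho>) = \<infinity>")
    case True
    then show ?thesis unfolding energy using \<alpha> by simp
  next
    case False
    define d where "d = (\<integral>x. (norm (G x))\<^sup>2 \<partial>\<rho>)"
    have intG: "integrable \<rho> (\<lambda>x. (norm (G x))\<^sup>2)"
      using False by (intro integrableI_nonneg) (auto simp: less_top)
    have d: "(\<integral>\<^sup>+x. ennreal ((norm (G x))\<^sup>2) \<partial>\<rho>) = ennreal d" "0 \<le> d"
      unfolding d_def using intG by (auto intro!: nn_integral_eq_integral)
    define \<phi> where "\<phi> x = (f x)\<^sup>2 * ln ((f x)\<^sup>2)" for x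
    define pos where "pos x = max 0 (\<phi> x)" for x
    define neg where "neg x = max 0 (- \<phi> x)" for x
    have [measurable]: "\<phi> \<in> borel_measurable borel" "pos \<in> borel_measurable borel" "neg \<in> borel_measurable borel"
      unfolding \<phi>_def[abs_def] pos_def[abs_def] neg_def[abs_def] by measurable
    have neg: "0 \<le> neg x" "neg x \<le> 1" for x
      using mult_ln_ge_minus_one[of "(f x)\<^sup>2"] by (auto simp: neg_def \<phi>_def)
    have intneg: "integrable \<rho> neg"
      by (rule integrable_const_bound[where B = 1]) (use neg in auto)
    define N where "N = (\<integral>x. neg x \<partial>\<rho>)"
    define t where "t n x = tent (real (Suc n)) x" for n and x :: "real ^ 'n"
    have t: "0 \<le> t n x" "t n x \<le> 1" for n x by (auto simp: t_def tent_nonneg intro: tent_le_1)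
    have [measurable]: "t n \<in> borel_measurable borel" for n unfolding t_def[abs_def] by measurable
    define a where "a n = (\<integral>x. (f x)\<^sup>2 * t n x \<partial>\<rho>)" for n
    define m where "m n = (\<integral>x. t n x \<partial>\<rho>)" for n
    have lima: "a \<longlonglongrightarrow> 1"
      using integral_tent_tendsto[OF sets intf(1)] intf(2) by (simp add: a_def[abs_def] t_def)
    have limm: "m \<longlonglongrightarrow> M"
      using integral_tent_tendsto[OF sets, of "\<lambda>_. 1"] by (simp add: m_def[abs_def] t_def[abs_def] M_def)
    \<comment> \<open>The local inequality bounds the positive part alone, because the negative part is integrable.\<close>
    have step: "(\<integral>\<^sup>+x. ennreal (pos x * t n x) \<partial>\<rho>) \<le> ennreal (N + 2 / \<alpha> * d + a n * ln (a n / m n))"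
      if am: "0 < a n" "0 < m n" for n
    proof -
      have *: "integrable \<rho> (\<lambda>x. \<phi> x * t n x)"
        "(\<integral>x. \<phi> x * t n x \<partial>\<rho>) - a n * ln (a n / m n) \<le> 2 / \<alpha> * (\<integral>x. (norm (G x))\<^sup>2 * t n x \<partial>\<rho>)"
        using local_log_sobolev[OF \<alpha> slc _ Df contG, of "real (Suc n)"] am
        unfolding \<phi>_def a_def m_def t_def by simp_all
      have le: "q x * t n x \<le> q x" if "0 \<le> q x" for q :: "real ^ 'n \<Rightarrow> real" and x
        using mult_left_mono[OF t(2) that] by simp
      have i: "integrable \<rho> (\<lambda>x. q x * t n x)" if "integrable \<rho> q" "\<And>x. 0 \<le> q x" for q
        using that t(1) le[of q] borel_measurable_integrable[OF that(1)]
        by (intro Bochner_Integration.integrable_bound[OF that(1)]) auto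
      have eq: "pos x * t n x = \<phi> x * t n x + neg x * t n x" for x
        by (simp add: pos_def neg_def max_def algebra_simps)
      have intpos: "integrable \<rho> (\<lambda>x. pos x * t n x)"
        unfolding eq using *(1) i[OF intneg neg(1)] by simp
      have "(\<integral>x. pos x * t n x \<partial>\<rho>) = (\<integral>x. \<phi> x * t n x \<partial>\<rho>) + (\<integral>x. neg x * t n x \<partial>\<rho>)"
        unfolding eq using *(1) i[OF intneg neg(1)] by simp
      moreover have "(\<integral>x. neg x * t n x \<partial>\<rho>) \<le> N"
        unfolding N_def using neg(1) by (intro integral_mono i intneg le)
      moreover have "(\<integral>x. (norm (G x))\<^sup>2 * t n x \<partial>\<rho>) \<le> d"
        unfolding d_def by (intro integral_mono i intG le) auto
      then have "2 / \<alpha> * (\<integral>x. (norm (G x))\<^sup>2 * t n x \<partial>\<rho>) \<le> 2 / \<alpha> * d"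
        using \<alpha> by (intro mult_left_mono) auto
      ultimately have "(\<integral>x. pos x * t n x \<partial>\<rho>) \<le> N + 2 / \<alpha> * d + a n * ln (a n / m n)"
        using *(2) by linarith
      moreover have "(\<integral>\<^sup>+x. ennreal (pos x * t n x) \<partial>\<rho>) = ennreal (\<integral>x. pos x * t n x \<partial>\<rho>)"
        using intpos t(1) by (intro nn_integral_eq_integral) (auto simp: pos_def)
      ultimately show ?thesis by (simp add: ennreal_leI)
    qed
    \<comment> \<open>Fatou removes the cutoff, and shows on the way that the positive part is integrable.\<close>
    have "(\<integral>\<^sup>+x. ennreal (pos x) \<partial>\<rho>) = (\<integral>\<^sup>+x. liminf (\<lambda>n. ennreal (pos x * t n x)) \<partial>\<rho>)"
    proof (rule nn_integral_cong)
      fix x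
      have "(\<lambda>n. pos x * t n x) \<longlonglongrightarrow> pos x * 1"
        unfolding t_def by (intro tendsto_mult tendsto_const tent_tendsto_1)
      then have "(\<lambda>n. ennreal (pos x * t n x)) \<longlonglongrightarrow> ennreal (pos x)" by (intro tendsto_ennrealI) simp
      then show "ennreal (pos x) = liminf (\<lambda>n. ennreal (pos x * t n x))"
        by (intro lim_imp_Liminf[symmetric]) auto
    qed
    also have "\<dots> \<le> liminf (\<lambda>n. \<integral>\<^sup>+x. ennreal (pos x * t n x) \<partial>\<rho>)"
      by (rule nn_integral_liminf) measurable
    also have "\<dots> \<le> liminf (\<lambda>n. ennreal (N + 2 / \<alpha> * d + a n * ln (a n / m n)))"
    proof (rule Liminf_mono)
      have "\<forall>\<^sub>F n in sequentially. 0 < a n" using lima by (rule order_tendstoD) simp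
      moreover have "\<forall>\<^sub>F n in sequentially. 0 < m n" using limm M by (intro order_tendstoD) auto
      ultimately show "\<forall>\<^sub>F n in sequentially. (\<integral>\<^sup>+x. ennreal (pos x * t n x) \<partial>\<rho>)
          \<le> ennreal (N + 2 / \<alpha> * d + a n * ln (a n / m n))"
        by eventually_elim (rule step)
    qed
    also have "\<dots> = ennreal (N + 2 / \<alpha> * d + 1 * ln (1 / M))"
      using M by (intro lim_imp_Liminf tendsto_ennrealI tendsto_intros lima limm) auto
    \<comment> \<open>Total mass at least \<open>1\<close> makes the normalization term nonpositive.\<close>
    also have "\<dots> \<le> ennreal (N + 2 / \<alpha> * d)"
      using M by (intro ennreal_leI) (simp add: ln_div)
    finally have bound: "(\<integral>\<^sup>+x. ennreal (pos x) \<partial>\<rho>) \<le> ennreal (N + 2 / \<alpha> * d)" .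
    then obtain P where P: "(\<integral>\<^sup>+x. ennreal (pos x) \<partial>\<rho>) = ennreal P" "0 \<le> P"
      by (metis ennreal_cases ennreal_less_top leD top_greatest)
    have N: "(\<integral>\<^sup>+x. ennreal (neg x) \<partial>\<rho>) = ennreal N" "0 \<le> N"
      unfolding N_def using intneg neg by (auto intro!: nn_integral_eq_integral)
    have "0 \<le> N + 2 / \<alpha> * d" using N(2) d(2) \<alpha> by simp
    then have "P \<le> N + 2 / \<alpha> * d" using bound P by (simp add: ennreal_le_iff)
    moreover have "extended_integral \<rho> (\<lambda>x. (f x)\<^sup>2 * ln ((f x)\<^sup>2)) = ereal (P - N)"
    proof -
      have "ennreal (\<phi> x) = ennreal (pos x)" "ennreal (- \<phi> x) = ennreal (neg x)" for x
        by (auto simp: pos_def neg_def max_def ennreal_neg)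
      then show ?thesis
        unfolding extended_integral_def \<phi>_def[symmetric] using P N by (simp add: enn2ereal_ennreal)
    qed
    moreover have "ereal (2 / \<alpha>) * extended_integral \<rho> (\<lambda>x. (norm (gradient f x))\<^sup>2) = ereal (2 / \<alpha> * d)"
      unfolding energy d(1) using d(2) by (simp add: enn2ereal_ennreal)
    ultimately show ?thesis by simp
  qed
qed

end
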